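(* There exists a family $\{Q_m : m\ge 0\}$ of special realizations of the combinatorial types $\widetilde Q_m$, in which each Hamilton path $\pi_m$ visits the vertices of $Q_m$ in the order given by increasing $x_4$-coordinate. This family may be realized inductively starting from the $4$-simplex $Q_0$ in such a way that for all $m\ge 0$, a realization of $Q_{m+1}$ with a monotone Hamilton path $\pi_{m+1}$ may be obtained from any realization of $Q_m$ with such a path $\pi_m$.
   Context: Let $m\ge0$ and $n=m+5$. $\widetilde Q_m$ denotes the combinatorial type of a simple $4$-dimensional polar-to-neighborly polytope with $n$ facets labeled $1,\dots,n$ whose vertices, each identified with the set of labels of the four facets containing it, are exactly the sets: (Type 1) $\{i,i+2,j,j+1\}$ with $1\le i$ and $i+3\le j\le n-1$; (Type 2a) $\{i,i+1,i+2,n\}$ with $1\le i\le n-3$; (Type 2b) $\{1,2,j,j+1\}$ with $3\le j\le n-1$. (Such a combinatorial type exists; $\widetilde Q_0$ is that of the $4$-simplex.) A realization of $\widetilde Q_m$ is a convex $4$-polytope in $\mathbb{R}^4$ of this combinatorial type, and $x_4$ is the fourth coordinate on $\mathbb{R}^4$. The Hamilton path $\pi_m$ in the graph of a realization of $\widetilde Q_m$ visits the vertices in the following order. First ("odd stage"), $\{i,i+1,i+2,n\}$ for $i=n-3,n-4,\dots,1$. Then ("even stage"), for $j=3,4,\dots,n-1$ in this order: first $\{i,i+2,j,j+1\}$ for $i=j-3,j-5,j-7,\dots$ as long as $i\ge1$; then $\{1,2,j,j+1\}$; then $\{i,i+2,j,j+1\}$ for $i=i_0,i_0+2,i_0+4,\dots$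 as long as $i\le j-4$, where $i_0=2$ if $j$ is even and $i_0=1$ if $j$ is odd. The path is monotone if it visits the vertices in the order of strictly increasing $x_4$-coordinate. *)

theory Defs
  imports "HOL-Analysis.Analysis"
begin

definition Q_type1 :: "nat \<Rightarrow> nat set set" where
  "Q_type1 n = {{i, i + 2, j, j + 1} | i j. 1 \<le> i \<and> i + 3 \<le> j \<and> j \<le> n - 1}"

definition Q_type2a :: "nat \<Rightarrow> nat set set" where
  "Q_type2a n = {{i, i + 1, i + 2, n} | i. 1 \<le> i \<and> i \<le> n - 3}"

definition Q_type2b :: "nat \<Rightarrow> nat set set" where
  "Q_type2b n = {{1, 2, j, j + 1} | j. 3 \<le> j \<and> j \<le> n - 1}"

definition Q_vertices :: "nat \<Rightarrow> nat set set" where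
  "Q_vertices m = Q_type1 (m + 5) \<union> Q_type2a (m + 5) \<union> Q_type2b (m + 5)"

definition label_set :: "nat \<Rightarrow> (nat \<Rightarrow> 'a set) \<Rightarrow> 'a \<Rightarrow> nat set" where
  "label_set m F v = {i \<in> {1..m + 5}. v \<in> F i}"

(* The vertex-facet incidences determine the face lattice of a polytope, so they pin down
   the combinatorial type.  Simplicity is implied: every label set in Q_vertices has exactly
   four elements. *)
definition realization :: "nat \<Rightarrow> (real ^ 4) set \<Rightarrow> (nat \<Rightarrow> (real ^ 4) set) \<Rightarrow> bool" where
  "realization m P F \<longleftrightarrow>
     polytope P \<and> aff_dim P = 4 \<and>
     bij_betw F {1..m + 5} {C. C facet_of P} \<and>
     bij_betw (label_set m F) {v. v extreme_point_of P} (Q_vertices m)"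

definition odd_stage :: "nat \<Rightarrow> nat set list" where
  "odd_stage n = map (\<lambda>i. {i, i + 1, i + 2, n}) (rev [1..<n - 2])"

(* The descending run i = j - 3, j - 5, ... consists of the i of parity opposite to j,
   the ascending run i = i0, i0 + 2, ... of those with the parity of j. *)
definition even_stage_block :: "nat \<Rightarrow> nat set list" where
  "even_stage_block j =
     map (\<lambda>i. {i, i + 2, j, j + 1}) (rev (filter (\<lambda>i. even i \<noteq> even j) [1..<j - 2]))
     @ [{1, 2, j, j + 1}]
     @ map (\<lambda>i. {i, i + 2, j, j + 1}) (filter (\<lambda>i. even i = even j) [1..<j - 3])"

definition pi_path :: "nat \<Rightarrow> nat set list" where
  "pi_path m = odd_stage (m + 5) @ concat (map even_stage_block [3..<m + 5])"

definition hamilton_path :: "'a::euclidean_space set \<Rightarrow> 'a list \<Rightarrow> bool" where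
  "hamilton_path P vs \<longleftrightarrow>
     distinct vs \<and> set vs = {v. v extreme_point_of P} \<and>
     (\<forall>k. Suc k < length vs \<longrightarrow> closed_segment (vs ! k) (vs ! Suc k) edge_of P)"

(* The index type 4 is arithmetic modulo 4; v $ 4 is the last of the coordinates
   v $ 1, v $ 2, v $ 3, v $ 4. *)
definition pi_monotone :: "nat \<Rightarrow> (real ^ 4) set \<Rightarrow> (nat \<Rightarrow> (real ^ 4) set) \<Rightarrow> bool" where
  "pi_monotone m P F \<longleftrightarrow>
     (\<exists>vs. hamilton_path P vs \<and> map (label_set m F) vs = pi_path m \<and>
           sorted_wrt (\<lambda>v w. v $ 4 < w $ 4) vs)"

(* The inductive step adds one facet: the new polytope is obtained from the old one by
   intersecting with a closed halfspace. *)
definition obtained_by_cut :: "'a::euclidean_space set \<Rightarrow> 'a set \<Rightarrow> bool" where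
  "obtained_by_cut P P' \<longleftrightarrow> (\<exists>a b. a \<noteq> 0 \<and> P' = P \<inter> {x. a \<bullet> x \<le> b})"

end

theory Submission
  imports Defs
begin

text \<open>Adding a facet to a polytope of type \<open>m\<close>, with \<open>n = m + 5\<close>
  facets, to obtain type \<open>m + 1\<close> can be done by one cut, if the new facet is given
  the label 1 and the label of every old facet is increased by one. (With the new facet labeled
  \<open>n + 1\<close> the last vertices of the new path would have to lie above the whole old
  polytope, which a cut cannot achieve.)

  Facets 1 and 2 meet in a polygon with vertices \<open>{1, 2, 3, n}\<close> and
  \<open>{1, 2, j, j + 1}\<close> for \<open>3 \<le> j \<le> n - 1\<close>. The cut removes all
  of them except \<open>{1, 2, 3, n}\<close>, which is the end of the odd stage. From each
  vertex \<open>{1, 2, j, j + 1}\<close> two edges leave the polygon, one inside facet 1 and one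
  inside facet 2. They carry new vertices with the new labels
  \<open>{1, 2, j + 1, j + 2}\<close> and \<open>{1, 3, j + 1, j + 2}\<close>; two more new
  vertices, \<open>{1, 2, 3, n + 1}\<close> and \<open>{1, 2, 3, 4}\<close>, lie on the polygon
  edges at \<open>{1, 2, 3, n}\<close>. The remaining vertices just have their labels shifted.

  On the level of paths (\<open>pi_path_Suc\<close>), the new path arises from the old one by
  inserting the two new polygon vertices after the odd stage and by replacing each
  \<open>{1, 2, j, j + 1}\<close> by its two new vertices, in an order that depends on the
  parity of \<open>j\<close>. The heights follow the same pattern if the cut is close to the
  polygon: then both new vertices are close to the vertex that they replace. The cutting
  function is a combination of the slacks of facets 1, 2, 3 and \<open>n\<close> with
  coefficients of very different size (\<open>cut_parameters\<close>). Letting the coefficient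
  of facet 1 dominate makes the new vertex inside facet 2 closer to the replaced vertex than the
  one inside facet 1, so that only the latter matters for the order of the two; and it lies
  towards the vertex \<open>{1, 3, j, j + 1}\<close> (\<open>{1, 3, 4, 5}\<close> for
  \<open>j = 3\<close>), whose place in the old path is known.

  The passage between geometry and labels uses systems of linear inequalities: a point is a
  vertex iff its tight normals span (\<open>extreme_iff_pinned\<close>), the vertices after a
  cut are the kept ones and the crossings of edges (\<open>cut_extreme_cases\<close>), and a
  simple polytope whose vertices have the right tight sets is a realization
  (\<open>realization_of_system\<close>).\<close>

section \<open>Vertices and edges of simple systems of inequalities\<close>

definition polyh :: "'i set \<Rightarrow> ('i \<Rightarrow> 'a::euclidean_space) \<Rightarrow> ('i \<Rightarrow> real) \<Rightarrow> 'a set" where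
  "polyh I a b = {x. \<forall>i\<in>I. b i \<le> a i \<bullet> x}"

definition tight :: "'i set \<Rightarrow> ('i \<Rightarrow> 'a::euclidean_space) \<Rightarrow> ('i \<Rightarrow> real) \<Rightarrow> 'a \<Rightarrow> 'i set" where
  "tight I a b x = {i\<in>I. a i \<bullet> x = b i}"

text \<open>No nonzero direction is orthogonal to all normals in \<open>T\<close>, that is, the
  normals span the space. Stating this through the kernel lets most arguments below avoid
  counting dimensions.\<close>

definition pinned :: "('i \<Rightarrow> 'a::euclidean_space) \<Rightarrow> 'i set \<Rightarrow> bool" where
  "pinned a T \<longleftrightarrow> (\<forall>d. (\<forall>i\<in>T. a i \<bullet> d = 0) \<longrightarrow> d = 0)"

lemma pinnedD: "pinned a T \<Longrightarrow> (\<And>i. i \<in> T \<Longrightarrow> a i \<bullet> d = 0) \<Longrightarrow> d = 0"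
  by (auto simp: pinned_def)

lemma convex_polyh: "convex (polyh I a b)"
proof -
  have "polyh I a b = (\<Inter>i\<in>I. {x. a i \<bullet> x \<ge> b i})"
    by (auto simp: polyh_def)
  then show ?thesis
    by (simp add: convex_INT convex_halfspace_ge)
qed

lemma closed_polyh: "closed (polyh I a b)"
proof -
  have "polyh I a b = (\<Inter>i\<in>I. {x. a i \<bullet> x \<ge> b i})"
    by (auto simp: polyh_def)
  then show ?thesis
    by (simp add: closed_INT closed_halfspace_ge)
qed

lemma polyhedron_polyh:
  assumes "finite I"
  shows "polyhedron (polyh I a b)"
proof -
  have "polyh I a b = \<Inter>((\<lambda>i. {x. a i \<bullet> x \<ge> b i}) ` I)"
    by (auto simp: polyh_def)
  moreover have "polyhedron (\<Inter>((\<lambda>i. {x. a i \<bullet> x \<ge> b i}) ` I))"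
    by (rule polyhedron_Inter) (use assms in \<open>auto simp: polyhedron_halfspace_ge\<close>)
  ultimately show ?thesis by simp
qed

lemma polyh_insert: "k \<notin> I \<Longrightarrow>
    polyh (insert k I) (a(k := c)) (b(k := e)) = polyh I a b \<inter> {x. e \<le> c \<bullet> x}"
  by (auto simp: polyh_def)

lemma small_step:
  fixes a :: "'i \<Rightarrow> 'a::euclidean_space"
  assumes "finite I"
  shows "\<exists>\<epsilon>>0. \<forall>t. \<bar>t\<bar> \<le> \<epsilon> \<longrightarrow> (\<forall>i\<in>I. b i < a i \<bullet> x \<longrightarrow> b i < a i \<bullet> (x + t *\<^sub>R d))"
  using assms
proof (induction I)
  case empty
  then show ?case by (auto intro: exI[of _ 1])
next
  case (insert i I)
  then obtain \<epsilon> where \<epsilon>: "\<epsilon> > 0"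
    "\<And>t k. \<bar>t\<bar> \<le> \<epsilon> \<Longrightarrow> k \<in> I \<Longrightarrow> b k < a k \<bullet> x \<Longrightarrow> b k < a k \<bullet> (x + t *\<^sub>R d)"
    by blast
  show ?case
  proof (cases "b i < a i \<bullet> x")
    case False
    then show ?thesis using \<epsilon> by auto
  next
    case True
    define \<delta> where "\<delta> = (a i \<bullet> x - b i) / (2 * (\<bar>a i \<bullet> d\<bar> + 1))"
    have \<delta>: "\<delta> > 0" using True by (simp add: \<delta>_def)
    have "b i < a i \<bullet> (x + t *\<^sub>R d)" if "\<bar>t\<bar> \<le> \<delta>" for t
    proof -
      have "\<bar>t * (a i \<bullet> d)\<bar> \<le> \<delta> * (\<bar>a i \<bullet> d\<bar> + 1)"
        using that unfolding abs_mult by (intro mult_mono) auto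
      also have "\<dots> = (a i \<bullet> x - b i) / 2"
        unfolding \<delta>_def by (simp add: field_simps)
      finally show ?thesis using True by (simp add: inner_add_right)
    qed
    then show ?thesis using \<epsilon> \<delta> by (intro exI[of _ "min \<epsilon> \<delta>"]) auto
  qed
qed

text \<open>A point is a vertex exactly when its tight constraints determine it: along a
  direction in the common kernel of the tight normals one can move a little both ways without
  leaving the polyhedron, and conversely an endpoint of a segment through the point inside the
  polyhedron would differ from it by such a direction.\<close>

lemma extreme_iff_pinned:
  fixes a :: "'i \<Rightarrow> 'a::euclidean_space"
  assumes "finite I"
  shows "x extreme_point_of polyh I a b \<longleftrightarrow> x \<in> polyh I a b \<and> pinned a (tight I a b x)"
proof
  assume x: "x extreme_point_of polyh I a b"
  then have xP: "x \<in> polyh I a b" by (simp add: extreme_point_of_def)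
  moreover have "d = 0" if d: "\<forall>i\<in>tight I a b x. a i \<bullet> d = 0" for d
  proof (rule ccontr)
    assume "d \<noteq> 0"
    obtain \<epsilon> where \<epsilon>: "\<epsilon> > 0"
      "\<And>t k. \<bar>t\<bar> \<le> \<epsilon> \<Longrightarrow> k \<in> I \<Longrightarrow> b k < a k \<bullet> x \<Longrightarrow> b k < a k \<bullet> (x + t *\<^sub>R d)"
      using small_step[OF assms] by metis
    have mem: "x + t *\<^sub>R d \<in> polyh I a b" if "\<bar>t\<bar> \<le> \<epsilon>" for t
      unfolding polyh_def
    proof safe
      fix i assume "i \<in> I"
      show "b i \<le> a i \<bullet> (x + t *\<^sub>R d)"
      proof (cases "a i \<bullet> x = b i")
        case True
        then show ?thesis using d \<open>i \<in> I\<close> by (auto simp: tight_def inner_add_right)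
      next
        case False
        then have "b i < a i \<bullet> x" using xP \<open>i \<in> I\<close> by (force simp: polyh_def)
        then show ?thesis using \<epsilon>(2)[OF that \<open>i \<in> I\<close>] by force
      qed
    qed
    have "x + (-\<epsilon>) *\<^sub>R d \<in> polyh I a b" "x + \<epsilon> *\<^sub>R d \<in> polyh I a b"
      using \<epsilon>(1) by (intro mem; simp)+
    moreover have "x \<in> open_segment (x + (-\<epsilon>) *\<^sub>R d) (x + \<epsilon> *\<^sub>R d)"
    proof -
      have "x = midpoint (x + (-\<epsilon>) *\<^sub>R d) (x + \<epsilon> *\<^sub>R d)"
        by (simp add: midpoint_def flip: scaleR_2)
      moreover have "x + (-\<epsilon>) *\<^sub>R d \<noteq> x + \<epsilon> *\<^sub>R d"
        using \<open>d \<noteq> 0\<close> \<epsilon>(1) by (simp del: scaleR_minus_left)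
      ultimately show ?thesis by (metis midpoint_in_open_segment)
    qed
    ultimately show False using x unfolding extreme_point_of_def by blast
  qed
  ultimately show "x \<in> polyh I a b \<and> pinned a (tight I a b x)"
    by (auto simp: pinned_def)
next
  assume x: "x \<in> polyh I a b \<and> pinned a (tight I a b x)"
  have False if uv: "u \<in> polyh I a b" "v \<in> polyh I a b" "x \<in> open_segment u v" for u v
  proof -
    obtain t where t: "0 < t" "t < 1" "x = (1 - t) *\<^sub>R u + t *\<^sub>R v" and "u \<noteq> v"
      using uv(3) by (auto simp: in_segment)
    have "a i \<bullet> (v - u) = 0" if "i \<in> tight I a b x" for i
    proof -
      have "b i \<le> a i \<bullet> u" "b i \<le> a i \<bullet> v" "a i \<bullet> x = b i"
        using uv that by (auto simp: polyh_def tight_def)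
      then have "(1 - t) * (a i \<bullet> u - b i) + t * (a i \<bullet> v - b i) = 0"
        using t(3) by (simp add: inner_add_right) (simp add: algebra_simps)
      moreover have "0 \<le> (1 - t) * (a i \<bullet> u - b i)" "0 \<le> t * (a i \<bullet> v - b i)"
        using t \<open>b i \<le> a i \<bullet> u\<close> \<open>b i \<le> a i \<bullet> v\<close> by auto
      ultimately have "(1 - t) * (a i \<bullet> u - b i) = 0" "t * (a i \<bullet> v - b i) = 0"
        by linarith+
      then show ?thesis using t by (simp add: inner_diff_right)
    qed
    then have "v - u = 0" using x pinnedD by blast
    then show False using \<open>u \<noteq> v\<close> by simp
  qed
  then show "x extreme_point_of polyh I a b"
    using x by (auto simp: extreme_point_of_def)
qed

lemma common_kernel:
  fixes a :: "'i \<Rightarrow> 'a::euclidean_space"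
  assumes "finite T" "card T < DIM('a)"
  shows "\<exists>d. d \<noteq> 0 \<and> (\<forall>i\<in>T. a i \<bullet> d = 0)"
proof -
  have "dim (a ` T) \<le> card (a ` T)"
    using assms by (intro dim_le_card') auto
  also have "\<dots> < DIM('a)"
    using card_image_le[OF assms(1), of a] assms(2) by simp
  finally obtain d where "d \<noteq> 0" "\<And>y. y \<in> span (a ` T) \<Longrightarrow> orthogonal d y"
    using orthogonal_to_subspace_exists by blast
  then show ?thesis
    by (intro exI[of _ d]) (metis imageI inner_commute orthogonal_def span_base)
qed

lemma tight_finite: "finite I \<Longrightarrow> finite (tight I a b x)"
  by (simp add: tight_def)

text \<open>The normals at a simple vertex form a basis, and these are the vectors of the dual
  basis, which point along the edges leaving the vertex.\<close>

lemma dual_direction: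
  fixes a :: "'i \<Rightarrow> 'a::euclidean_space"
  assumes "finite T" "card T = DIM('a)" "pinned a T" "k \<in> T"
  shows "\<exists>d. a k \<bullet> d = 1 \<and> (\<forall>i\<in>T - {k}. a i \<bullet> d = 0)"
proof -
  have "card (T - {k}) < DIM('a)"
    using assms by (metis card_Diff1_less)
  then obtain d where d: "d \<noteq> 0" "\<forall>i\<in>T - {k}. a i \<bullet> d = 0"
    using common_kernel[of "T - {k}" a] assms(1) by auto
  have "a k \<bullet> d \<noteq> 0"
  proof
    assume "a k \<bullet> d = 0"
    then have "d = 0" using d(2) by (intro pinnedD[OF assms(3)]) blast
    then show False using d(1) by simp
  qed
  then show ?thesis
    using d(2) by (intro exI[of _ "(1 / (a k \<bullet> d)) *\<^sub>R d"]) auto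
qed

text \<open>At a simple vertex any subset of the tight constraints can be kept tight while all
  others are released: step a little in the direction of the sum of the released dual
  vectors.\<close>

lemma loosen:
  fixes a :: "'i \<Rightarrow> 'a::euclidean_space"
  assumes fin: "finite I" and v: "v \<in> polyh I a b" "pinned a (tight I a b v)"
    and card: "card (tight I a b v) = DIM('a)" and S: "S \<subseteq> tight I a b v"
  shows "\<exists>x\<in>polyh I a b. tight I a b x = S"
proof -
  let ?T = "tight I a b v"
  have finT: "finite ?T" using fin by (rule tight_finite)
  have "\<forall>k\<in>?T. \<exists>d. a k \<bullet> d = 1 \<and> (\<forall>i\<in>?T - {k}. a i \<bullet> d = 0)"
    using dual_direction[OF finT card v(2)] by blast
  then obtain D where D: "\<And>k. k \<in> ?T \<Longrightarrow> a k \<bullet> D k = 1"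
      "\<And>k i. k \<in> ?T \<Longrightarrow> i \<in> ?T \<Longrightarrow> i \<noteq> k \<Longrightarrow> a i \<bullet> D k = 0"
    by (metis Diff_iff singletonD)
  define d where "d = (\<Sum>k\<in>?T - S. D k)"
  have d: "a i \<bullet> d = (if i \<in> S then 0 else 1)" if "i \<in> ?T" for i
  proof -
    have "a i \<bullet> d = (\<Sum>k\<in>?T - S. if k = i then 1 else 0)"
      unfolding d_def inner_sum_right using D that by (intro sum.cong) auto
    also have "\<dots> = (if i \<in> S then 0 else 1)"
      using finT that by (simp add: sum.delta')
    finally show ?thesis .
  qed
  obtain \<epsilon> where \<epsilon>: "\<epsilon> > 0"
      "\<And>t k. \<bar>t\<bar> \<le> \<epsilon> \<Longrightarrow> k \<in> I \<Longrightarrow> b k < a k \<bullet> v \<Longrightarrow> b k < a k \<bullet> (v + t *\<^sub>R d)"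
    using small_step[OF fin] by metis
  let ?x = "v + \<epsilon> *\<^sub>R d"
  have on: "a i \<bullet> ?x = b i + (if i \<in> S then 0 else \<epsilon>)" if "i \<in> ?T" for i
    using d[OF that] that by (auto simp: tight_def inner_add_right)
  have off: "b i < a i \<bullet> ?x" if "i \<in> I" "i \<notin> ?T" for i
    using that v(1) \<epsilon> by (force simp: tight_def polyh_def)
  have "b i \<le> a i \<bullet> ?x" if "i \<in> I" for i
    using on[of i] off[of i] that \<epsilon>(1) by (cases "i \<in> ?T") auto
  then have "?x \<in> polyh I a b" by (auto simp: polyh_def)
  moreover have "i \<in> tight I a b ?x \<longleftrightarrow> i \<in> S" for i
  proof (cases "i \<in> ?T")
    case True
    then show ?thesis using on[of i] \<epsilon>(1) by (auto simp: tight_def)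
  next
    case False
    then show ?thesis using off[of i] S by (auto simp: tight_def)
  qed
  ultimately show ?thesis by blast
qed

text \<open>A simple polytope given by a system of inequalities; the index set is kept abstract
  so that a constraint can be added under a fresh index.\<close>

locale simple_system =
  fixes I :: "'i set" and a :: "'i \<Rightarrow> 'a::euclidean_space" and b :: "'i \<Rightarrow> real"
  assumes finI: "finite I"
    and bnd: "bounded (polyh I a b)"
    and simple: "x extreme_point_of polyh I a b \<Longrightarrow> card (tight I a b x) = DIM('a)"
begin

abbreviation "P \<equiv> polyh I a b"
abbreviation "L \<equiv> tight I a b"

lemmas ext_iff = extreme_iff_pinned[OF finI]

lemma finL: "finite (L x)"
  by (rule tight_finite[OF finI])

lemma in_P: "x extreme_point_of P \<Longrightarrow> x \<in> P"
  by (simp add: extreme_point_of_def)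

lemma tight_inj:
  assumes "x extreme_point_of P" "L x \<subseteq> L y"
  shows "x = y"
proof -
  have "a i \<bullet> (y - x) = 0" if "i \<in> L x" for i
    using assms(2) that by (auto simp: tight_def inner_diff_right)
  then have "y - x = 0" using assms(1) ext_iff pinnedD by blast
  then show ?thesis by simp
qed

text \<open>Dropping one constraint from a simple vertex leaves a line of directions, so two
  vertices that share all but one of their constraints span that line.\<close>

lemma edge_direction:
  assumes u: "u extreme_point_of P" and uv: "u \<noteq> v"
    and c: "card (L u \<inter> L v) = DIM('a) - 1"
    and d: "\<And>i. i \<in> L u \<inter> L v \<Longrightarrow> a i \<bullet> d = 0"
  shows "\<exists>t. d = t *\<^sub>R (v - u)"
proof -
  have "card (L u - L v) = 1"
    using simple[OF u] c finL card_Diff_subset_Int[of "L u" "L v"] by (simp add: DIM_positive Suc_leI)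
  then obtain k where k: "L u - L v = {k}" by (auto simp: card_1_singleton_iff)
  have nz: "a k \<bullet> (v - u) \<noteq> 0"
  proof -
    have "k \<in> L u" "k \<notin> L v" using k by auto
    then show ?thesis by (auto simp: tight_def inner_diff_right)
  qed
  define t where "t = (a k \<bullet> d) / (a k \<bullet> (v - u))"
  have "a i \<bullet> (d - t *\<^sub>R (v - u)) = 0" if "i \<in> L u" for i
  proof (cases "i = k")
    case True
    then show ?thesis using nz by (simp add: t_def inner_diff_right)
  next
    case False
    then have "i \<in> L u \<inter> L v" using that k by auto
    then have "a i \<bullet> d = 0" "a i \<bullet> (v - u) = 0"
      using d by (auto simp: tight_def inner_diff_right)
    then show ?thesis by (simp add: inner_diff_right)
  qed
  then have "d - t *\<^sub>R (v - u) = 0" using u ext_iff pinnedD by blast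
  then show ?thesis by auto
qed

lemma edge_segment:
  assumes u: "u extreme_point_of P" and v: "v extreme_point_of P" and uv: "u \<noteq> v"
    and c: "card (L u \<inter> L v) = DIM('a) - 1"
  shows "closed_segment u v edge_of P"
proof -
  let ?T = "L u \<inter> L v"
  let ?s = "\<Sum>i\<in>?T. a i" and ?r = "\<Sum>i\<in>?T. b i"
  have fin: "finite ?T" using finL by blast
  have seg: "closed_segment u v \<subseteq> P"
    using in_P[OF u] in_P[OF v] convex_polyh by (intro closed_segment_subset)
  have "P \<inter> {x. ?s \<bullet> x = ?r} = closed_segment u v"
  proof (intro equalityI subsetI)
    fix x assume x: "x \<in> P \<inter> {x. ?s \<bullet> x = ?r}"
    have "(\<Sum>i\<in>?T. a i \<bullet> x - b i) = 0"
      using x by (simp add: sum_subtractf inner_sum_left)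
    moreover have nn: "\<forall>i\<in>?T. 0 \<le> a i \<bullet> x - b i"
      using x by (auto simp: polyh_def tight_def)
    ultimately have z: "\<And>i. i \<in> ?T \<Longrightarrow> a i \<bullet> x = b i"
      using sum_nonneg_eq_0_iff[OF fin, of "\<lambda>i. a i \<bullet> x - b i"] by auto
    have "a i \<bullet> (x - u) = 0" if "i \<in> ?T" for i
      using z[OF that] that by (simp add: tight_def inner_diff_right)
    then obtain t where "x - u = t *\<^sub>R (v - u)"
      using edge_direction[OF u uv c] by blast
    then have xt: "x = (1 - t) *\<^sub>R u + t *\<^sub>R v"
      by (simp add: algebra_simps)
    have lt: "card (L u \<inter> L v) < card (L u)" "card (L u \<inter> L v) < card (L v)"
      using c simple[OF u] simple[OF v] by (simp_all add: DIM_positive)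
    have "0 \<le> t"
    proof -
      obtain k where k: "k \<in> L u" "k \<notin> L v" using lt(1) by (metis Int_absorb2 less_irrefl subsetI)
      then have "a k \<bullet> u = b k" "b k < a k \<bullet> v" "b k \<le> a k \<bullet> x"
        using in_P[OF v] x by (force simp: polyh_def tight_def)+
      then have "0 < a k \<bullet> v - b k" "0 \<le> t * (a k \<bullet> v - b k)"
        by (simp_all add: xt inner_add_right algebra_simps)
      then show ?thesis by (simp add: zero_le_mult_iff)
    qed
    moreover have "t \<le> 1"
    proof -
      obtain k where k: "k \<in> L v" "k \<notin> L u" using lt(2) by (metis Int_absorb1 less_irrefl subsetI)
      then have "a k \<bullet> v = b k" "b k < a k \<bullet> u" "b k \<le> a k \<bullet> x"
        using in_P[OF u] x by (force simp: polyh_def tight_def)+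
      then have "0 < a k \<bullet> u - b k" "0 \<le> (1 - t) * (a k \<bullet> u - b k)"
        by (simp_all add: xt inner_add_right algebra_simps)
      then show ?thesis by (simp add: zero_le_mult_iff)
    qed
    ultimately show "x \<in> closed_segment u v" using xt by (auto simp: in_segment)
  next
    fix x assume x: "x \<in> closed_segment u v"
    then obtain t where t: "x = (1 - t) *\<^sub>R u + t *\<^sub>R v" by (auto simp: in_segment)
    have "a i \<bullet> x = b i" if "i \<in> ?T" for i
      using that by (auto simp: t tight_def inner_add_right algebra_simps)
    then have "?s \<bullet> x = ?r" by (simp add: inner_sum_left)
    then show "x \<in> P \<inter> {x. ?s \<bullet> x = ?r}" using seg x by auto
  qed
  moreover have "P \<inter> {x. ?s \<bullet> x = ?r} face_of P"
    by (rule face_of_Int_supporting_hyperplane_ge[OF convex_polyh])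
      (auto simp: inner_sum_left polyh_def tight_def intro!: sum_mono)
  moreover have "aff_dim (closed_segment u v) = 1"
    using uv by (metis aff_dim_convex_hull aff_dim_2 segment_convex_hull)
  ultimately show ?thesis by (simp add: edge_of_def)
qed


text \<open>Boundedness forces a ray inside the polytope to hit a constraint that is not
  constant along it.\<close>

lemma ray_exit:
  assumes x: "x \<in> P" and d: "d \<noteq> 0" "\<And>i. i \<in> L x \<Longrightarrow> a i \<bullet> d = 0"
  shows "\<exists>t>0. x + t *\<^sub>R d \<in> P \<and> L x \<subseteq> L (x + t *\<^sub>R d) \<and> (\<exists>i\<in>L (x + t *\<^sub>R d). a i \<bullet> d \<noteq> 0)"
proof -
  have stays: "L x \<subseteq> L (x + t *\<^sub>R d)" for t
    using d(2) by (auto simp: tight_def inner_add_right)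
  have extend: "\<exists>\<epsilon>>0. \<forall>s. 0 \<le> s \<longrightarrow> s \<le> \<epsilon> \<longrightarrow> y + s *\<^sub>R d \<in> P"
    if y: "y \<in> P" "\<And>i. i \<in> L y \<Longrightarrow> a i \<bullet> d = 0" for y
  proof -
    obtain \<epsilon> where \<epsilon>: "\<epsilon> > 0"
      "\<And>t k. \<bar>t\<bar> \<le> \<epsilon> \<Longrightarrow> k \<in> I \<Longrightarrow> b k < a k \<bullet> y \<Longrightarrow> b k < a k \<bullet> (y + t *\<^sub>R d)"
      using small_step[OF finI] by metis
    have "b i \<le> a i \<bullet> (y + s *\<^sub>R d)" if "0 \<le> s" "s \<le> \<epsilon>" "i \<in> I" for s i
    proof (cases "i \<in> L y")
      case True
      then show ?thesis using y(2) by (simp add: tight_def inner_add_right)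
    next
      case False
      then have "b i < a i \<bullet> y" using y(1) that(3) by (force simp: polyh_def tight_def)
      then show ?thesis using \<epsilon>(2)[of s i] that by fastforce
    qed
    then show ?thesis using \<epsilon>(1) by (intro exI[of _ \<epsilon>]) (auto simp: polyh_def)
  qed
  define A where "A = {t. x + t *\<^sub>R d \<in> P}"
  have "closed A"
  proof -
    have "A = (\<lambda>t. x + t *\<^sub>R d) -` P" by (auto simp: A_def)
    then show ?thesis
      using closed_polyh by (auto intro!: closed_vimage continuous_intros)
  qed
  moreover have "bounded A"
  proof -
    obtain B where B: "\<And>y. y \<in> P \<Longrightarrow> norm y \<le> B" using bnd by (auto simp: bounded_iff)
    have "\<bar>t\<bar> \<le> (B + norm x) / norm d" if "t \<in> A" for t
    proof -
      have "\<bar>t\<bar> * norm d = norm ((x + t *\<^sub>R d) - x)" by simp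
      also have "\<dots> \<le> B + norm x"
        using B[of "x + t *\<^sub>R d"] that norm_triangle_ineq4[of "x + t *\<^sub>R d" x] by (simp add: A_def)
      finally show ?thesis using d(1) by (simp add: field_simps)
    qed
    then show ?thesis by (auto simp: bounded_iff)
  qed
  moreover have "0 \<in> A" using x by (simp add: A_def)
  ultimately obtain t where t: "t \<in> A" "\<And>s. s \<in> A \<Longrightarrow> s \<le> t"
    using compact_attains_sup[of A] by (auto simp: compact_eq_bounded_closed)
  let ?y = "x + t *\<^sub>R d"
  obtain \<epsilon> where "\<epsilon> > 0" "x + \<epsilon> *\<^sub>R d \<in> P" using extend[OF x d(2)] by force
  then have "t > 0" using t(2)[of \<epsilon>] by (simp add: A_def)
  moreover have "\<exists>i\<in>L ?y. a i \<bullet> d \<noteq> 0"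
  proof (rule ccontr)
    assume "\<not> ?thesis"
    moreover have "?y \<in> P" using t(1) by (simp add: A_def)
    ultimately obtain \<delta> where "\<delta> > 0" "?y + \<delta> *\<^sub>R d \<in> P" using extend[of ?y] by force
    then have "t + \<delta> \<in> A" by (simp add: A_def scaleR_add_left add.assoc)
    then show False using t(2)[of "t + \<delta>"] \<open>\<delta> > 0\<close> by simp
  qed
  ultimately show ?thesis using t(1) stays unfolding A_def by blast
qed

end

text \<open>The point at which the line through \<open>u\<close> and \<open>v\<close> meets the
  hyperplane \<open>c \<bullet> x = e\<close>.\<close>

definition crossing :: "'a::euclidean_space \<Rightarrow> real \<Rightarrow> 'a \<Rightarrow> 'a \<Rightarrow> 'a" where
  "crossing c e u v = u + ((e - c \<bullet> u) / (c \<bullet> v - c \<bullet> u)) *\<^sub>R (v - u)"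

lemma crossing_on:
  assumes "c \<bullet> u < e" "e < c \<bullet> v"
  shows "c \<bullet> crossing c e u v = e"
  using assms by (simp add: crossing_def inner_add_right inner_diff_right)

lemma crossing_param:
  assumes "c \<bullet> u < e" "e < c \<bullet> v"
  shows "0 < (e - c \<bullet> u) / (c \<bullet> v - c \<bullet> u)" "(e - c \<bullet> u) / (c \<bullet> v - c \<bullet> u) < 1"
  using assms by (simp_all add: field_simps)

lemma tight_insert:
  assumes "k \<notin> I"
  shows "tight (insert k I) (a(k := c)) (b(k := e)) x =
    (if c \<bullet> x = e then insert k (tight I a b x) else tight I a b x)"
  using assms by (auto simp: tight_def)

lemma pinned_cong: "(\<And>i. i \<in> T \<Longrightarrow> a i = a' i) \<Longrightarrow> pinned a T \<longleftrightarrow> pinned a' T"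
  by (auto simp: pinned_def)

context simple_system
begin

lemma pinned_upd: "k \<notin> I \<Longrightarrow> pinned (a(k := c)) (L x) \<longleftrightarrow> pinned a (L x)"
  by (rule pinned_cong) (auto simp: tight_def)

lemma pinned_insert_upd: "k \<notin> I \<Longrightarrow> pinned (a(k := c)) (insert k (L x)) \<longleftrightarrow>
    (\<forall>d. c \<bullet> d = 0 \<longrightarrow> (\<forall>i\<in>L x. a i \<bullet> d = 0) \<longrightarrow> d = 0)"
  by (auto simp: tight_def pinned_def)

lemma cut_extreme_iff: "k \<notin> I \<Longrightarrow> x extreme_point_of polyh (insert k I) (a(k := c)) (b(k := e)) \<longleftrightarrow>
    x \<in> P \<and> e \<le> c \<bullet> x \<and> pinned (a(k := c)) (if c \<bullet> x = e then insert k (L x) else L x)"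
  using finI by (subst extreme_iff_pinned) (simp_all add: tight_insert polyh_insert)

lemma tight_crossing:
  assumes u: "u \<in> P" "c \<bullet> u < e" and v: "v \<in> P" "e < c \<bullet> v"
  shows "crossing c e u v \<in> P" "L (crossing c e u v) = L u \<inter> L v"
proof -
  define t where "t = (e - c \<bullet> u) / (c \<bullet> v - c \<bullet> u)"
  have t: "0 < t" "t < 1" using crossing_param[OF u(2) v(2)] by (simp_all add: t_def)
  have x: "crossing c e u v = (1 - t) *\<^sub>R u + t *\<^sub>R v"
    by (simp add: crossing_def t_def algebra_simps)
  show "crossing c e u v \<in> P"
    unfolding x using u v t convex_polyh by (auto intro!: convexD)
  have "a i \<bullet> crossing c e u v = b i \<longleftrightarrow> a i \<bullet> u = b i \<and> a i \<bullet> v = b i" if "i \<in> I" for i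
  proof -
    have nn: "0 \<le> a i \<bullet> u - b i" "0 \<le> a i \<bullet> v - b i"
      using u v that by (auto simp: polyh_def)
    have "a i \<bullet> crossing c e u v - b i = (1 - t) * (a i \<bullet> u - b i) + t * (a i \<bullet> v - b i)"
      unfolding x by (simp add: inner_add_right algebra_simps)
    moreover have "0 \<le> (1 - t) * (a i \<bullet> u - b i)" "0 \<le> t * (a i \<bullet> v - b i)"
      using nn t by auto
    ultimately have "a i \<bullet> crossing c e u v - b i = 0 \<longleftrightarrow>
        (1 - t) * (a i \<bullet> u - b i) = 0 \<and> t * (a i \<bullet> v - b i) = 0"
      by linarith
    then show ?thesis using t by auto
  qed
  then show "L (crossing c e u v) = L u \<inter> L v" by (auto simp: tight_def)
qed

lemma cut_extreme_new:
  assumes u: "u extreme_point_of P" "c \<bullet> u < e" and v: "v extreme_point_of P" "e < c \<bullet> v"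
    and card: "card (L u \<inter> L v) = DIM('a) - 1" and k: "k \<notin> I"
  shows "crossing c e u v extreme_point_of polyh (insert k I) (a(k := c)) (b(k := e))"
proof -
  let ?x = "crossing c e u v"
  note x = tight_crossing[OF in_P[OF u(1)] u(2) in_P[OF v(1)] v(2)]
  have on: "c \<bullet> ?x = e" using u v by (intro crossing_on)
  have "d = 0" if d: "c \<bullet> d = 0" "\<forall>i\<in>L ?x. a i \<bullet> d = 0" for d
  proof -
    obtain t where t: "d = t *\<^sub>R (v - u)"
      using edge_direction[OF u(1) _ card, of d] d(2) u v x(2) by force
    then have "t * (c \<bullet> v - c \<bullet> u) = 0" using d(1) by (simp add: inner_diff_right)
    then show "d = 0" using t u v by auto
  qed
  then show ?thesis
    using x(1) on k by (simp add: cut_extreme_iff pinned_insert_upd)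
qed

lemma cut_extreme_old:
  assumes "u extreme_point_of P" "e < c \<bullet> u" and k: "k \<notin> I"
  shows "u extreme_point_of polyh (insert k I) (a(k := c)) (b(k := e))"
  using assms ext_iff[of u] by (simp add: cut_extreme_iff pinned_upd)

text \<open>Cutting a simple polytope by a hyperplane that avoids its vertices creates vertices
  only where the hyperplane crosses an edge. At a vertex on the hyperplane the old tight normals
  have a one-dimensional kernel; following that line in both directions leads to two old
  vertices, and the hyperplane separates them because it is not parallel to the line.\<close>

lemma cut_extreme_cases:
  assumes gen: "\<And>v. v extreme_point_of P \<Longrightarrow> c \<bullet> v \<noteq> e" and k: "k \<notin> I"
    and x: "x extreme_point_of polyh (insert k I) (a(k := c)) (b(k := e))"
  obtains (old) "x extreme_point_of P" "e < c \<bullet> x"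
  | (new) u v where "u extreme_point_of P" "c \<bullet> u < e" "v extreme_point_of P" "e < c \<bullet> v"
      "card (L u \<inter> L v) = DIM('a) - 1" "x = crossing c e u v"
proof (cases "c \<bullet> x = e")
  case False
  then have "x extreme_point_of P" "e < c \<bullet> x"
    using x k ext_iff[of x] by (auto simp: cut_extreme_iff pinned_upd)
  then show ?thesis by (rule old)
next
  case True
  have xP: "x \<in> P"
    and pin: "\<And>d. c \<bullet> d = 0 \<Longrightarrow> (\<And>i. i \<in> L x \<Longrightarrow> a i \<bullet> d = 0) \<Longrightarrow> d = 0"
    using x k True by (auto simp: cut_extreme_iff pinned_insert_upd)
  have "\<not> pinned a (L x)" using gen True xP ext_iff by blast
  then obtain d0 where d0: "d0 \<noteq> 0" "\<forall>i\<in>L x. a i \<bullet> d0 = 0" by (auto simp: pinned_def)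
  then have "c \<bullet> d0 \<noteq> 0" using pin by blast
  define d where "d = sgn (c \<bullet> d0) *\<^sub>R d0"
  have cd: "c \<bullet> d > 0" using \<open>c \<bullet> d0 \<noteq> 0\<close> by (simp add: d_def sgn_if)
  then have dnz: "d \<noteq> 0" by auto
  have dk: "\<And>i. i \<in> L x \<Longrightarrow> a i \<bullet> d = 0" using d0 by (simp add: d_def)
  have line: "\<exists>s. d' = s *\<^sub>R d" if d': "\<And>i. i \<in> L x \<Longrightarrow> a i \<bullet> d' = 0" for d'
  proof -
    have "d' - ((c \<bullet> d') / (c \<bullet> d)) *\<^sub>R d = 0"
      using cd dk d' by (intro pin) (auto simp: inner_diff_right)
    then show ?thesis by auto
  qed
  have vertex: "y extreme_point_of P" if y: "y \<in> P" "L x \<subseteq> L y" "i \<in> L y" "a i \<bullet> d \<noteq> 0" for y i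
  proof -
    have "d' = 0" if d': "\<forall>i\<in>L y. a i \<bullet> d' = 0" for d'
    proof -
      obtain s where "d' = s *\<^sub>R d" using line[of d'] d' y(2) by auto
      then show ?thesis using d' y(3,4) by auto
    qed
    then show ?thesis using y(1) ext_iff by (auto simp: pinned_def)
  qed
  obtain t where t: "t > 0" "x + t *\<^sub>R d \<in> P" "L x \<subseteq> L (x + t *\<^sub>R d)"
      and "\<exists>i\<in>L (x + t *\<^sub>R d). a i \<bullet> d \<noteq> 0"
    using ray_exit[OF xP dnz dk] by blast
  then obtain i where i: "i \<in> L (x + t *\<^sub>R d)" "a i \<bullet> d \<noteq> 0" by blast
  obtain s where s: "s > 0" "x + s *\<^sub>R (- d) \<in> P" "L x \<subseteq> L (x + s *\<^sub>R (- d))"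
      and "\<exists>i\<in>L (x + s *\<^sub>R (- d)). a i \<bullet> (- d) \<noteq> 0"
    using ray_exit[OF xP, of "- d"] dnz dk by auto
  then obtain j where j: "j \<in> L (x + s *\<^sub>R (- d))" "a j \<bullet> d \<noteq> 0" by auto
  define u where "u = x + s *\<^sub>R (- d)"
  define v where "v = x + t *\<^sub>R d"
  have u: "u extreme_point_of P" "c \<bullet> u < e"
    using vertex[of u j] s j cd True by (auto simp: u_def inner_diff_right)
  have v: "v extreme_point_of P" "e < c \<bullet> v"
    using vertex[of v i] t i cd True by (auto simp: v_def inner_add_right)
  have "crossing c e u v = x"
  proof -
    have "(e - c \<bullet> u) / (c \<bullet> v - c \<bullet> u) = s / (s + t)"
    proof -
      have "e - c \<bullet> u = s * (c \<bullet> d)" "c \<bullet> v - c \<bullet> u = (s + t) * (c \<bullet> d)"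
        using True by (simp_all add: u_def v_def inner_diff_right inner_add_right algebra_simps)
      then show ?thesis using cd by simp
    qed
    moreover have "v - u = (s + t) *\<^sub>R d" by (simp add: u_def v_def algebra_simps)
    ultimately show ?thesis using s(1) t(1) by (simp add: crossing_def u_def)
  qed
  moreover from this have "L x = L u \<inter> L v"
    using tight_crossing(2)[OF in_P[OF u(1)] u(2) in_P[OF v(1)] v(2)] by simp
  moreover have "card (L x) = DIM('a) - 1"
  proof -
    have "L x \<subset> L v" using t(3) i dk by (auto simp: v_def)
    then have "card (L x) < DIM('a)" using simple[OF v(1)] finL psubset_card_mono by metis
    moreover have "\<not> card (insert k (L x)) < DIM('a)"
    proof
      assume "card (insert k (L x)) < DIM('a)"
      then obtain d' where "d' \<noteq> 0" "\<forall>i\<in>insert k (L x). (a(k := c)) i \<bullet> d' = 0"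
        using common_kernel[of "insert k (L x)" "a(k := c)"] finL by auto
      moreover have "k \<notin> L x" using k by (simp add: tight_def)
      ultimately show False using pin[of d'] by (metis fun_upd_apply insert_iff)
    qed
    moreover have "card (insert k (L x)) \<le> Suc (card (L x))" by (rule card_insert_le_m1) auto
    ultimately show ?thesis by linarith
  qed
  ultimately show ?thesis using new[OF u v] by simp
qed


lemma cut_simple:
  assumes gen: "\<And>v. v extreme_point_of P \<Longrightarrow> c \<bullet> v \<noteq> e" and k: "k \<notin> I"
  shows "simple_system (insert k I) (a(k := c)) (b(k := e))"
proof
  show "finite (insert k I)" using finI by simp
  show "bounded (polyh (insert k I) (a(k := c)) (b(k := e)))"
    using bnd k by (simp add: polyh_insert bounded_Int)
  fix x assume "x extreme_point_of polyh (insert k I) (a(k := c)) (b(k := e))"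
  from gen k this show "card (tight (insert k I) (a(k := c)) (b(k := e)) x) = DIM('a)"
  proof (rule cut_extreme_cases)
    assume "x extreme_point_of P" "e < c \<bullet> x"
    then show ?thesis using simple k by (simp add: tight_insert)
  next
    fix u v
    assume new: "u extreme_point_of P" "c \<bullet> u < e" "v extreme_point_of P" "e < c \<bullet> v"
      "card (L u \<inter> L v) = DIM('a) - 1" "x = crossing c e u v"
    have "c \<bullet> x = e" using new crossing_on by metis
    moreover have "L x = L u \<inter> L v" using new tight_crossing in_P by metis
    moreover have "k \<notin> L u \<inter> L v" using k by (simp add: tight_def)
    ultimately show ?thesis
      using new(5) k finL by (simp add: tight_insert DIM_positive)
  qed
qed

text \<open>Every constraint that is tight at some simple vertex defines a facet: by
  \<open>loosen\<close> there is a point where it alone is tight, and pushing that point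
  slightly outwards violates it alone, so the system of inequalities is irredundant.\<close>

lemma facets:
  assumes ne: "I \<noteq> {}"
    and cover: "\<And>i. i \<in> I \<Longrightarrow> \<exists>v. v extreme_point_of P \<and> i \<in> L v"
  shows "aff_dim P = int (DIM('a))"
    and "bij_betw (\<lambda>i. {x\<in>P. a i \<bullet> x = b i}) I {C. C facet_of P}"
proof -
  have ex: "\<exists>x\<in>P. L x = S" if "v extreme_point_of P" "S \<subseteq> L v" for v S
    using loosen[OF finI] that simple ext_iff by blast
  have "\<exists>x0\<in>P. L x0 = {}" using ne cover ex by (metis all_not_in_conv empty_subsetI)
  then obtain x0 where x0: "x0 \<in> P" "\<And>i. i \<in> I \<Longrightarrow> b i < a i \<bullet> x0"
    by (force simp: polyh_def tight_def)
  have "\<forall>i\<in>I. \<exists>x\<in>P. L x = {i}" using cover ex by blast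
  then obtain X where X: "\<And>i. i \<in> I \<Longrightarrow> X i \<in> P" "\<And>i. i \<in> I \<Longrightarrow> L (X i) = {i}" by metis
  have "open (\<Inter>i\<in>I. {x. b i < a i \<bullet> x})"
    using finI by (intro open_INT) (auto simp: open_halfspace_gt)
  moreover have "(\<Inter>i\<in>I. {x. b i < a i \<bullet> x}) \<subseteq> P" by (force simp: polyh_def)
  ultimately have "x0 \<in> interior P" using x0(2) by (intro interiorI) auto
  then show "aff_dim P = int (DIM('a))" by (intro aff_dim_nonempty_interior) auto
  then have full: "affine hull P = UNIV" by (simp add: aff_dim_eq_full)
  have Xi: "a i \<bullet> X i = b i" if "i \<in> I" for i
    using X[OF that] by (auto simp: tight_def)
  have viol: "\<exists>y. a i \<bullet> y < b i \<and> (\<forall>j\<in>I - {i}. b j \<le> a j \<bullet> y)" if i: "i \<in> I" for i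
  proof -
    obtain \<epsilon> where \<epsilon>: "\<epsilon> > 0" "\<And>t k. \<bar>t\<bar> \<le> \<epsilon> \<Longrightarrow> k \<in> I \<Longrightarrow> b k < a k \<bullet> X i \<Longrightarrow>
        b k < a k \<bullet> (X i + t *\<^sub>R (X i - x0))"
      using small_step[OF finI] by metis
    have "a i \<bullet> (X i + \<epsilon> *\<^sub>R (X i - x0)) = b i - \<epsilon> * (a i \<bullet> x0 - b i)"
      using Xi[OF i] by (simp add: inner_add_right inner_diff_right algebra_simps)
    then have "a i \<bullet> (X i + \<epsilon> *\<^sub>R (X i - x0)) < b i" using \<epsilon>(1) x0(2)[OF i] by simp
    moreover have "b j \<le> a j \<bullet> (X i + \<epsilon> *\<^sub>R (X i - x0))" if "j \<in> I - {i}" for j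
    proof -
      have "b j < a j \<bullet> X i" using X[OF i] that by (force simp: polyh_def tight_def)
      then show ?thesis using \<epsilon> that by (intro less_imp_le) auto
    qed
    ultimately show ?thesis by blast
  qed
  define h where "h i = {x. b i \<le> a i \<bullet> x}" for i
  have inj_h: "inj_on h I"
  proof (rule inj_onI, rule ccontr)
    fix i j assume ij: "i \<in> I" "j \<in> I" "h i = h j" "i \<noteq> j"
    obtain y where "a i \<bullet> y < b i" "\<forall>j\<in>I - {i}. b j \<le> a j \<bullet> y" using viol[OF ij(1)] by blast
    then have "y \<notin> h i" "y \<in> h j" using ij(1,2,4) by (auto simp: h_def)
    then show False using ij(3) by simp
  qed
  define g where "g = inv_into I h"
  have g: "g (h i) = i" if "i \<in> I" for i using inj_h that by (simp add: g_def)
  have anz: "a i \<noteq> 0" if "i \<in> I" for i using Xi[OF that] x0(2)[OF that] by auto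
  have P_eq: "P = affine hull P \<inter> \<Inter>(h ` I)" using full by (auto simp: polyh_def h_def)
  have iff: "C facet_of P \<longleftrightarrow> (\<exists>H. H \<in> h ` I \<and> C = P \<inter> {x. (- a (g H)) \<bullet> x = - b (g H)})" for C
  proof (rule facet_of_polyhedron_explicit[OF _ P_eq])
    show "finite (h ` I)" using finI by simp
    show "- a (g H) \<noteq> 0 \<and> H = {x. - a (g H) \<bullet> x \<le> - b (g H)}" if "H \<in> h ` I" for H
      using that g anz by (auto simp: h_def)
    show "P \<subset> affine hull P \<inter> \<Inter>F'" if F': "F' \<subset> h ` I" for F'
    proof -
      obtain i where i: "i \<in> I" "h i \<notin> F'" using F' by blast
      obtain y where y: "a i \<bullet> y < b i" "\<forall>j\<in>I - {i}. b j \<le> a j \<bullet> y" using viol[OF i(1)] by blast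
      have "y \<in> \<Inter>F'"
      proof
        fix H assume "H \<in> F'"
        then obtain j where "j \<in> I" "H = h j" using F' by auto
        moreover have "j \<noteq> i" using i \<open>H \<in> F'\<close> \<open>H = h j\<close> by auto
        ultimately show "y \<in> H" using y(2) by (auto simp: h_def)
      qed
      moreover have "y \<notin> P" using y(1) i(1) by (force simp: polyh_def not_le)
      moreover have "P \<subseteq> \<Inter>F'" using P_eq F' by blast
      ultimately show ?thesis using full by auto
    qed
  qed
  let ?F = "\<lambda>i. {x\<in>P. a i \<bullet> x = b i}"
  have "{C. C facet_of P} = ?F ` I"
    by (auto simp: iff g image_iff Int_def)
  moreover have "inj_on ?F I"
  proof (rule inj_onI)
    fix i j assume ij: "i \<in> I" "j \<in> I" "?F i = ?F j"
    have "X i \<in> ?F i" using X Xi ij(1) by simp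
    then have "X i \<in> ?F j" using ij(3) by simp
    then have "j \<in> L (X i)" using ij(2) by (simp add: tight_def)
    then show "i = j" using X(2) ij(1) by simp
  qed
  ultimately show "bij_betw ?F I {C. C facet_of P}" by (simp add: bij_betw_def)
qed

end

text \<open>A full-dimensional polyhedron is described by one inequality per facet. The
  inequalities come from an irredundant description by halfspaces; two of its halfspaces cannot
  cut out the same facet, for otherwise the segment from an interior point to a point violating
  only one of them would leave the polyhedron through a point on just one of the two boundary
  hyperplanes.\<close>

lemma facet_inequalities:
  fixes P :: "'a::euclidean_space set"
  assumes P: "polyhedron P" and full: "affine hull P = UNIV"
    and F: "bij_betw F I {C. C facet_of P}"
  shows "\<exists>a b. P = polyh I a b \<and> (\<forall>i\<in>I. F i = {x\<in>P. a i \<bullet> x = b i})"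
proof -
  obtain H where fin: "finite H" and P_eq: "P = affine hull P \<inter> \<Inter>H"
    and half: "\<forall>h\<in>H. \<exists>a b. a \<noteq> 0 \<and> h = {x. a \<bullet> x \<le> b}"
    and sub: "\<And>F'. F' \<subset> H \<Longrightarrow> P \<subset> affine hull P \<inter> \<Inter>F'"
    using P unfolding polyhedron_Int_affine_minimal by metis
  obtain \<alpha> \<beta> where ab: "\<And>h. h \<in> H \<Longrightarrow> \<alpha> h \<noteq> 0 \<and> h = {x. \<alpha> h \<bullet> x \<le> \<beta> h}"
    using half by metis
  have facet: "C facet_of P \<longleftrightarrow> (\<exists>h. h \<in> H \<and> C = P \<inter> {x. \<alpha> h \<bullet> x = \<beta> h})" for C
    by (rule facet_of_polyhedron_explicit[OF fin P_eq]) (fact ab sub)+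
  have "rel_interior P \<noteq> {}"
    using P full polyhedron_imp_convex rel_interior_eq_empty by fastforce
  then obtain z where "z \<in> rel_interior P" by blast
  then have z: "\<And>h. h \<in> H \<Longrightarrow> \<alpha> h \<bullet> z < \<beta> h"
    using rel_interior_polyhedron_explicit[OF fin P_eq ab sub] by simp
  have mem: "x \<in> P \<longleftrightarrow> (\<forall>h\<in>H. \<alpha> h \<bullet> x \<le> \<beta> h)" for x
    using P_eq full ab by auto
  have inj: "h = h'" if h: "h \<in> H" "h' \<in> H"
    and eq: "P \<inter> {x. \<alpha> h \<bullet> x = \<beta> h} = P \<inter> {x. \<alpha> h' \<bullet> x = \<beta> h'}" for h h'
  proof (rule ccontr)
    assume ne: "h \<noteq> h'"
    have "P \<subset> \<Inter>(H - {h'})" using sub[of "H - {h'}"] h(2) full by auto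
    then obtain x where x: "x \<in> \<Inter>(H - {h'})" "x \<notin> P" by blast
    then have others: "\<alpha> k \<bullet> x \<le> \<beta> k" if "k \<in> H" "k \<noteq> h'" for k
      using ab that by blast
    then have out: "\<beta> h' < \<alpha> h' \<bullet> x" using x(2) mem by force
    define t where "t = (\<beta> h' - \<alpha> h' \<bullet> z) / (\<alpha> h' \<bullet> x - \<alpha> h' \<bullet> z)"
    have t: "0 < t" "t < 1" using out z[OF h(2)] by (simp_all add: t_def field_simps)
    define y where "y = z + t *\<^sub>R (x - z)"
    have y: "\<alpha> h' \<bullet> y = \<beta> h'"
      using out z[OF h(2)] by (simp add: y_def t_def inner_add_right inner_diff_right)
    have y': "\<alpha> k \<bullet> y < \<beta> k" if "k \<in> H" "k \<noteq> h'" for k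
    proof -
      have "\<alpha> k \<bullet> y = (1 - t) * (\<alpha> k \<bullet> z) + t * (\<alpha> k \<bullet> x)"
        by (simp add: y_def inner_add_right inner_diff_right algebra_simps)
      also have "\<dots> < (1 - t) * \<beta> k + t * \<beta> k"
        using t z[OF that(1)] others[OF that]
        by (intro add_less_le_mono mult_strict_left_mono mult_left_mono) auto
      finally show ?thesis by (simp add: algebra_simps)
    qed
    have "y \<in> P" unfolding mem using y y' by (metis less_eq_real_def)
    then have "\<alpha> h \<bullet> y = \<beta> h" using eq y by auto
    then show False using y'[OF h(1) ne] by simp
  qed
  have facetF: "F i facet_of P" if "i \<in> I" for i
    using F that by (auto simp: bij_betw_def)
  define G where "G i = (SOME h. h \<in> H \<and> F i = P \<inter> {x. \<alpha> h \<bullet> x = \<beta> h})" for i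
  have G: "G i \<in> H \<and> F i = P \<inter> {x. \<alpha> (G i) \<bullet> x = \<beta> (G i)}" if "i \<in> I" for i
    unfolding G_def using facetF[OF that] unfolding facet by (rule someI_ex)
  have "G ` I = H"
  proof (intro equalityI subsetI)
    fix h assume h: "h \<in> H"
    then have "P \<inter> {x. \<alpha> h \<bullet> x = \<beta> h} facet_of P" using facet by blast
    then obtain i where i: "i \<in> I" "F i = P \<inter> {x. \<alpha> h \<bullet> x = \<beta> h}"
      using F unfolding bij_betw_def by (metis imageE mem_Collect_eq)
    then have "G i = h" using inj[of "G i" h] G[of i] h by simp
    then show "h \<in> G ` I" using i by blast
  qed (use G in auto)
  then have "P = polyh I (\<lambda>i. - \<alpha> (G i)) (\<lambda>i. - \<beta> (G i))"
    using mem by (auto simp: polyh_def)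
  moreover have "\<forall>i\<in>I. F i = {x\<in>P. (- \<alpha> (G i)) \<bullet> x = - \<beta> (G i)}"
    using G by auto
  ultimately show ?thesis by blast
qed

section \<open>Label sets of the vertices\<close>

text \<open>The labels of the vertices that the inductive step cuts off. They contain 1 and 2,
  so these vertices lie on the polygon in which facets 1 and 2 meet.\<close>

abbreviation hinge :: "nat \<Rightarrow> nat set" where "hinge j \<equiv> {1, 2, j, j + 1}"

lemma Q_vertices_cases:
  assumes "S \<in> Q_vertices m"
  obtains (type1) i j where "S = {i, i + 2, j, j + 1}" "1 \<le> i" "i + 3 \<le> j" "j \<le> m + 4"
  | (type2a) i where "S = {i, i + 1, i + 2, m + 5}" "1 \<le> i" "i \<le> m + 2"
  | (type2b) j where "S = hinge j" "3 \<le> j" "j \<le> m + 4"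
  using assms by (auto simp: Q_vertices_def Q_type1_def Q_type2a_def Q_type2b_def)

lemma Q_type1I: "1 \<le> i \<Longrightarrow> i + 3 \<le> j \<Longrightarrow> j \<le> m + 4 \<Longrightarrow> {i, i + 2, j, j + 1} \<in> Q_vertices m"
  unfolding Q_vertices_def Q_type1_def by (intro UnI1 CollectI exI[of _ i] exI[of _ j]) simp

lemma Q_type2aI: "1 \<le> i \<Longrightarrow> i \<le> m + 2 \<Longrightarrow> {i, i + 1, i + 2, m + 5} \<in> Q_vertices m"
  by (auto simp: Q_vertices_def Q_type2a_def)

lemma hinge_in_Q: "3 \<le> j \<Longrightarrow> j \<le> m + 4 \<Longrightarrow> hinge j \<in> Q_vertices m"
  by (auto simp: Q_vertices_def Q_type2b_def)

lemma Q_vertices_card: "S \<in> Q_vertices m \<Longrightarrow> card S = 4"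
  by (erule Q_vertices_cases) (auto simp: card_insert_if)

lemma Q_vertices_subset: "S \<in> Q_vertices m \<Longrightarrow> S \<subseteq> {1..m + 5}"
  by (erule Q_vertices_cases) auto

lemma finite_Q_vertices: "finite (Q_vertices m)"
  by (rule finite_subset[of _ "Pow {1..m + 5}"]) (use Q_vertices_subset in auto)

lemma Q_vertices_cover:
  assumes "i \<in> {1..m + 5}"
  shows "\<exists>S\<in>Q_vertices m. i \<in> S"
proof -
  define j where "j = (if i \<le> 2 then 3 else if i \<le> m + 4 then i else m + 4)"
  have "i = 1 \<or> i = 2 \<or> i = j \<or> i = j + 1" and j: "3 \<le> j" "j \<le> m + 4"
    using assms by (auto simp: j_def)
  then have "i \<in> hinge j" by simp
  then show ?thesis using hinge_in_Q[OF j] by (rule bexI)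
qed

text \<open>The polygon of facets 1 and 2 has exactly one vertex besides those labeled by the
  hinges.\<close>

lemma Q_both_1_2:
  assumes "S \<in> Q_vertices m" "1 \<in> S" "2 \<in> S"
  obtains "S = {1, 2, 3, m + 5}" | j where "3 \<le> j" "j \<le> m + 4" "S = hinge j"
  using assms(1)
proof (cases rule: Q_vertices_cases)
  case (type1 i j)
  then show ?thesis using assms(2,3) by auto
next
  case (type2a i)
  then have "i = 1" using assms(2) by auto
  then show ?thesis using type2a that(1) by (simp add: numeral_eq_Suc)
next
  case (type2b j)
  then show ?thesis using that(2) by auto
qed

text \<open>Adding the new facet as number 1 shifts all old labels up by one, and every vertex
  that is not cut off keeps its (shifted) label set.\<close>

lemma Suc_image_Q:
  assumes "S \<in> Q_vertices m" "\<not> (1 \<in> S \<and> 2 \<in> S) \<or> S = {1, 2, 3, m + 5}"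
  shows "Suc ` S \<in> Q_vertices (Suc m)"
  using assms(1)
proof (cases rule: Q_vertices_cases)
  case (type1 i j)
  then show ?thesis using Q_type1I[of "Suc i" "Suc j" "Suc m"] by simp
next
  case (type2a i)
  then show ?thesis using Q_type2aI[of "Suc i" "Suc m"] by simp
next
  case (type2b j)
  then have "hinge j = {1, 2, 3, m + 5}" using assms(2) by simp
  then have "j \<in> {1, 2, 3, m + 5}" "j + 1 \<in> {1, 2, 3, m + 5}" by blast+
  then have False using type2b by auto
  then show ?thesis ..
qed

lemma Q_Suc_cases:
  assumes "S' \<in> Q_vertices (Suc m)"
  obtains (old) S where "S \<in> Q_vertices m" "\<not> (1 \<in> S \<and> 2 \<in> S) \<or> S = {1, 2, 3, m + 5}" "S' = Suc ` S"
  | (first) "S' = {1, 2, 3, m + 6}" | (second) "S' = {1, 2, 3, 4}"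
  | (a) j where "3 \<le> j" "j \<le> m + 4" "S' = {1, 3, j + 1, j + 2}"
  | (b) j where "3 \<le> j" "j \<le> m + 4" "S' = {1, 2, j + 1, j + 2}"
  using assms
proof (cases rule: Q_vertices_cases)
  case (type1 i j)
  obtain j' where j': "j = Suc j'" using type1 by (cases j) auto
  show ?thesis
  proof (cases "i = 1")
    case True
    then show ?thesis using type1 j' a[of j'] by (simp add: numeral_eq_Suc)
  next
    case False
    then obtain i' where i': "i = Suc i'" "1 \<le> i'" using type1 by (cases i) auto
    have "{i', i' + 2, j', j' + 1} \<in> Q_vertices m"
      using type1 i' j' by (intro Q_type1I) auto
    moreover have "S' = Suc ` {i', i' + 2, j', j' + 1}" using type1(1) i' j' by simp
    moreover have "\<not> (1 \<in> {i', i' + 2, j', j' + 1} \<and> 2 \<in> {i', i' + 2, j', j' + 1})"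
      using type1 i' j' by auto
    ultimately show ?thesis using old by blast
  qed
next
  case (type2a i)
  show ?thesis
  proof (cases "i = 1")
    case True
    then show ?thesis using type2a first by (simp add: numeral_eq_Suc)
  next
    case False
    then obtain i' where i': "i = Suc i'" "1 \<le> i'" using type2a by (cases i) auto
    have "{i', i' + 1, i' + 2, m + 5} \<in> Q_vertices m"
      using type2a i' by (intro Q_type2aI) auto
    moreover have "S' = Suc ` {i', i' + 1, i' + 2, m + 5}" using type2a(1) i' by simp
    moreover have "i' \<noteq> 1 \<Longrightarrow> 1 \<notin> {i', i' + 1, i' + 2, m + 5}"
      using i' by auto
    moreover have "i' = 1 \<Longrightarrow> {i', i' + 1, i' + 2, m + 5} = {1, 2, 3, m + 5}"
      by (simp add: numeral_eq_Suc)
    ultimately show ?thesis using old by blast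
  qed
next
  case (type2b j)
  show ?thesis
  proof (cases "j = 3")
    case True
    then show ?thesis using type2b second by simp
  next
    case False
    then obtain j' where "j = Suc j'" "3 \<le> j'" using type2b by (cases j) auto
    then show ?thesis using type2b b[of j'] by simp
  qed
qed

lemma new_labels_in_Q:
  "{1, 2, 3, m + 6} \<in> Q_vertices (Suc m)"
  "{1, 2, 3, 4} \<in> Q_vertices (Suc m)"
  "3 \<le> j \<Longrightarrow> j \<le> m + 4 \<Longrightarrow> {1, 3, j + 1, j + 2} \<in> Q_vertices (Suc m)"
  "3 \<le> j \<Longrightarrow> j \<le> m + 4 \<Longrightarrow> {1, 2, j + 1, j + 2} \<in> Q_vertices (Suc m)"
proof -
  show "{1, 2, 3, m + 6} \<in> Q_vertices (Suc m)"
    using Q_type2aI[of 1 "Suc m"] by (simp add: numeral_eq_Suc)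
  show "{1, 2, 3, 4} \<in> Q_vertices (Suc m)"
    using hinge_in_Q[of 3 "Suc m"] by simp
  show "{1, 3, j + 1, j + 2} \<in> Q_vertices (Suc m)" if "3 \<le> j" "j \<le> m + 4"
    using Q_type1I[of 1 "j + 1" "Suc m"] that by (simp add: numeral_eq_Suc)
  show "{1, 2, j + 1, j + 2} \<in> Q_vertices (Suc m)" if "3 \<le> j" "j \<le> m + 4"
    using hinge_in_Q[of "j + 1" "Suc m"] that by simp
qed

text \<open>Away from the polygon of facets 1 and 2, each hinge vertex has two neighbours, one
  still on facet 1 and one still on facet 2. The first must be known explicitly, because its
  place in the path decides on which side of the hinge vertex the new vertex comes to lie; the
  maximum covers the first hinge, whose neighbour belongs to the next block.\<close>

lemma hinge_neighbours:
  assumes "3 \<le> j" "j \<le> m + 4"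
  shows "{1, 3, max j 4, max j 4 + 1} \<in> Q_vertices m"
    and "hinge j \<inter> {1, 3, max j 4, max j 4 + 1} = {1, j, j + 1}"
    and "\<exists>S\<in>Q_vertices m. hinge j \<inter> S = {2, j, j + 1} \<and> 1 \<notin> S"
proof -
  show "{1, 3, max j 4, max j 4 + 1} \<in> Q_vertices m"
    using Q_type1I[of 1 "max j 4" m] assms by (simp add: numeral_3_eq_3)
  show "hinge j \<inter> {1, 3, max j 4, max j 4 + 1} = {1, j, j + 1}"
  proof (cases "j = 3")
    case True
    then show ?thesis by auto
  next
    case False
    then have "max j 4 = j" "3 < j" using assms by auto
    then show ?thesis by auto
  qed
  consider "j = 3 \<or> j = 4 \<and> m = 0" | "j = 4" "m > 0" | "j \<ge> 5" using assms by linarith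
  then show "\<exists>S\<in>Q_vertices m. hinge j \<inter> S = {2, j, j + 1} \<and> 1 \<notin> S"
  proof cases
    case 1
    then have "hinge j \<inter> {2, 3, 4, m + 5} = {2, j, j + 1} \<and> 1 \<notin> {2, 3, 4, m + 5}"
      by auto
    moreover have "{2, 3, 4, m + 5} \<in> Q_vertices m"
      using Q_type2aI[of 2 m] by simp
    ultimately show ?thesis by blast
  next
    case 2
    then have "hinge j \<inter> {2, 4, 5, 6} = {2, j, j + 1} \<and> 1 \<notin> {2, 4, 5, 6 :: nat}"
      by auto
    moreover have "{2, 4, 5, 6} \<in> Q_vertices m"
      using Q_type1I[of 2 5 m] 2 by simp
    ultimately show ?thesis by blast
  next
    case 3
    then have "hinge j \<inter> {2, 4, j, j + 1} = {2, j, j + 1} \<and> 1 \<notin> {2, 4, j, j + 1}"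
      by auto
    moreover have "{2, 4, j, j + 1} \<in> Q_vertices m"
      using Q_type1I[of 2 j m] assms 3 by simp
    ultimately show ?thesis by blast
  qed
qed

section \<open>The Hamilton path\<close>

definition down_run :: "nat \<Rightarrow> nat list" where
  "down_run j = filter (\<lambda>i. even i \<noteq> even j) [1..<j - 2]"

definition up_run :: "nat \<Rightarrow> nat list" where
  "up_run j = filter (\<lambda>i. even i = even j) [1..<j - 3]"

lemma even_stage_block_eq:
  "even_stage_block j = map (\<lambda>i. {i, i + 2, j, j + 1}) (rev (down_run j)) @ [hinge j]
     @ map (\<lambda>i. {i, i + 2, j, j + 1}) (up_run j)"
  by (simp add: even_stage_block_def down_run_def up_run_def)

abbreviation even_stage :: "nat \<Rightarrow> nat set list" where
  "even_stage m \<equiv> concat (map even_stage_block [3..<m + 5])"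

lemma set_even_stage_block:
  assumes "3 \<le> j"
  shows "set (even_stage_block j) = {{i, i + 2, j, j + 1} |i. 1 \<le> i \<and> i + 3 \<le> j} \<union> {hinge j}"
proof -
  have "i \<in> set (down_run j) \<union> set (up_run j) \<longleftrightarrow> 1 \<le> i \<and> i + 3 \<le> j" for i
  proof -
    have "i + 3 \<le> j \<longleftrightarrow> i < j - 2" using assms by linarith
    moreover have "i < j - 3 \<or> i = j - 3" if "i < j - 2" using that assms by linarith
    moreover have "even i \<noteq> even j" if "i = j - 3" using that assms by simp
    ultimately show ?thesis
      by (auto simp: down_run_def up_run_def)
  qed
  then show ?thesis unfolding even_stage_block_eq by auto
qed

lemma set_pi_path: "set (pi_path m) = Q_vertices m"
proof -
  have "set (odd_stage (m + 5)) = Q_type2a (m + 5)"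
    by (auto simp: odd_stage_def Q_type2a_def image_iff)
  moreover have "set (even_stage m) = Q_type1 (m + 5) \<union> Q_type2b (m + 5)"
  proof -
    have "set (even_stage m) = (\<Union>j\<in>{3..<m + 5}. set (even_stage_block j))" by simp
    also have "\<dots> = (\<Union>j\<in>{3..<m + 5}. {{i, i + 2, j, j + 1} |i. 1 \<le> i \<and> i + 3 \<le> j} \<union> {hinge j})"
      by (intro SUP_cong) (simp_all add: set_even_stage_block)
    also have "\<dots> = Q_type1 (m + 5) \<union> Q_type2b (m + 5)"
    proof -
      have "(\<Union>j\<in>{3..<m + 5}. {f i j |i. 1 \<le> i \<and> i + 3 \<le> j} \<union> {g j}) =
          {f i j |i j. 1 \<le> i \<and> i + 3 \<le> j \<and> j \<le> m + 5 - 1} \<union> {g j |j. 3 \<le> j \<and> j \<le> m + 5 - 1}"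
        for f :: "nat \<Rightarrow> nat \<Rightarrow> nat set" and g
        by fastforce
      then show ?thesis unfolding Q_type1_def Q_type2b_def .
    qed
    finally show ?thesis .
  qed
  ultimately show ?thesis
    by (auto simp: pi_path_def Q_vertices_def)
qed

text \<open>How a step of the path is replaced when passing to the next polytope: a hinge vertex
  is replaced by the two new vertices on its edges leaving the polygon of facets 1 and 2, in an
  order depending on parity; every other vertex is kept. The maximal element of
  \<open>hinge j\<close> is \<open>j + 1\<close>.\<close>

definition split_label :: "nat set \<Rightarrow> nat set list" where
  "split_label S =
     (if 1 \<in> S \<and> 2 \<in> S then
        let k = Max S in
        if odd k then [{1, 2, k, k + 1}, {1, 3, k, k + 1}] else [{1, 3, k, k + 1}, {1, 2, k, k + 1}]
      else [Suc ` S])"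

lemma split_hinge:
  assumes "3 \<le> j"
  shows "split_label (hinge j) =
    (if even j then [{1, 2, j + 1, j + 2}, {1, 3, j + 1, j + 2}]
     else [{1, 3, j + 1, j + 2}, {1, 2, j + 1, j + 2}])"
proof -
  have "Max (hinge j) = j + 1" using assms by (intro Max_eqI) auto
  then show ?thesis by (simp add: split_label_def)
qed

lemma upt_1_Suc: "[Suc 0..<Suc k] = (if k = 0 then [] else Suc 0 # map Suc [Suc 0..<k])"
  by (simp add: map_Suc_upt upt_conv_Cons del: upt_Suc)

lemma down_run_Suc: "3 \<le> j \<Longrightarrow> down_run (Suc j) = (if odd j then [1] else []) @ map Suc (down_run j)"
proof -
  assume "3 \<le> j"
  then have "Suc j - 2 = Suc (j - 2)" "j - 2 \<noteq> 0" by auto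
  then show ?thesis
    unfolding down_run_def by (simp add: upt_1_Suc filter_map o_def del: upt_Suc)
qed

lemma up_run_Suc: "3 \<le> j \<Longrightarrow> up_run (Suc j) = (if even j then [1] else []) @ map Suc (up_run j)"
proof -
  assume j: "3 \<le> j"
  show ?thesis
  proof (cases "j = 3")
    case False
    then have "Suc j - 3 = Suc (j - 3)" "j - 3 \<noteq> 0" using j by auto
    then show ?thesis
      unfolding up_run_def by (simp add: upt_1_Suc filter_map o_def del: upt_Suc)
  qed (simp add: up_run_def)
qed

text \<open>Shifting the labels of a block gives the next block except at the hinge vertex. The
  run that receives the new index 1 depends on parity, and this is the order recorded in
  \<open>split_label\<close>.\<close>

lemma even_stage_block_Suc:
  assumes j: "3 \<le> j"
  shows "even_stage_block (Suc j) = concat (map split_label (even_stage_block j))"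
proof -
  have single: "split_label {i, i + 2, j, j + 1} = [{Suc i, Suc i + 2, Suc j, Suc j + 1}]"
    if "1 \<le> i" "i + 3 \<le> j" for i
    using that by (auto simp: split_label_def)
  have runs: "concat (map split_label (map (\<lambda>i. {i, i + 2, j, j + 1}) xs)) =
      map (\<lambda>i. {i, i + 2, Suc j, Suc j + 1}) (map Suc xs)"
    if "\<forall>i\<in>set xs. 1 \<le> i \<and> i + 3 \<le> j" for xs
    using that
  proof (induction xs)
    case (Cons x xs)
    then show ?case using single[of x] by simp
  qed simp
  have "\<forall>i\<in>set (rev (down_run j)). 1 \<le> i \<and> i + 3 \<le> j" "\<forall>i\<in>set (up_run j). 1 \<le> i \<and> i + 3 \<le> j"
    by (auto simp: down_run_def up_run_def)
  note r = this[THEN runs]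
  have "concat (map split_label (even_stage_block j)) =
      map (\<lambda>i. {i, i + 2, Suc j, Suc j + 1}) (map Suc (rev (down_run j)))
      @ split_label (hinge j) @ map (\<lambda>i. {i, i + 2, Suc j, Suc j + 1}) (map Suc (up_run j))"
    unfolding even_stage_block_eq
    by (simp only: map_append concat_append r list.map concat.simps append_Nil2)
  then show ?thesis
    unfolding even_stage_block_eq[of "Suc j"] split_hinge[OF j] down_run_Suc[OF j] up_run_Suc[OF j]
    by (auto simp: rev_map numeral_eq_Suc)
qed

lemma odd_stage_Suc:
  "odd_stage (Suc m + 5) = map ((`) Suc) (odd_stage (m + 5)) @ [{1, 2, 3, m + 6}]"
proof -
  have "Suc m + 5 - 2 = Suc (m + 3)" by simp
  then have "[1..<Suc m + 5 - 2] = 1 # map Suc [1..<m + 3]"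
    by (simp only: upt_1_Suc One_nat_def) simp
  moreover have "m + 5 - 2 = m + 3" by simp
  ultimately show ?thesis
    unfolding odd_stage_def by (simp add: rev_map numeral_eq_Suc del: upt_Suc)
qed

text \<open>The new path follows the old one: the odd stage is kept and extended by the two new
  vertices that lie on the polygon of facets 1 and 2, and the even stage is refined at the
  hinges.\<close>

lemma pi_path_Suc:
  "pi_path (Suc m) = map ((`) Suc) (odd_stage (m + 5)) @ [{1, 2, 3, m + 6}, {1, 2, 3, 4}]
     @ concat (map split_label (even_stage m))"
proof -
  have "[3..<Suc m + 5] = 3 # map Suc [3..<m + 5]"
    by (simp add: map_Suc_upt upt_conv_Cons del: upt_Suc)
  then have "even_stage (Suc m) = even_stage_block 3 @ concat (map (\<lambda>j. even_stage_block (Suc j)) [3..<m + 5])"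
    by (simp add: o_def)
  also have "map (\<lambda>j. even_stage_block (Suc j)) [3..<m + 5] =
      map (\<lambda>j. concat (map split_label (even_stage_block j))) [3..<m + 5]"
    by (intro map_cong) (auto simp: even_stage_block_Suc)
  also have "concat \<dots> = concat (map split_label (even_stage m))"
  proof -
    have "concat (map (\<lambda>j. concat (map split_label (even_stage_block j))) xs) =
        concat (map split_label (concat (map even_stage_block xs)))" for xs
      by (induction xs) simp_all
    then show ?thesis .
  qed
  also have "even_stage_block 3 = [{1, 2, 3, 4}]" by (simp add: even_stage_block_def)
  finally show ?thesis
    unfolding pi_path_def odd_stage_Suc by simp
qed

lemma odd_stage_last: "\<exists>xs. odd_stage (m + 5) = xs @ [{1, 2, 3, m + 5}]"
  by (simp add: odd_stage_def upt_conv_Cons numeral_eq_Suc del: upt_Suc)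

lemma even_stage_first: "\<exists>ys. even_stage m = hinge 3 # ys"
  by (simp add: upt_conv_Cons even_stage_block_def del: upt_Suc)

text \<open>The vertex that ends the edge of \<open>hinge j\<close> inside facet 1 closes the
  descending run of its block when \<open>j\<close> is even and opens the ascending run when
  \<open>j\<close> is odd; the first hinge has no run, and there this vertex belongs to the next
  block.\<close>

lemma pi_path_hinge_order:
  assumes sorted: "sorted_wrt R (pi_path m)" and j: "3 \<le> j" "j \<le> m + 4"
  shows "if even j then R {1, 3, max j 4, max j 4 + 1} (hinge j)
         else R (hinge j) {1, 3, max j 4, max j 4 + 1}"
proof -
  have es: "sorted_wrt R (even_stage m)"
    using sorted by (simp add: pi_path_def sorted_wrt_append)
  show ?thesis
  proof (cases "j = 3")
    case True
    obtain ys where ys: "even_stage m = hinge 3 # ys" using even_stage_first by blast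
    have "{1, 3, 4, 5} \<in> set (even_stage_block 4)"
      by (subst set_even_stage_block) (auto intro!: exI[of _ 1] simp: numeral_eq_Suc)
    then have "{1, 3, 4, 5} \<in> set (even_stage m)" by auto
    moreover have "{1, 3, 4, 5} \<noteq> hinge 3" by auto
    ultimately have "{1, 3, 4, 5} \<in> set ys" unfolding ys by simp
    then have "R (hinge 3) {1, 3, 4, 5}" using es unfolding ys by simp
    then show ?thesis using True by simp
  next
    case False
    have "j \<in> set [3..<m + 5]" using j by simp
    then obtain xs ys where "[3..<m + 5] = xs @ j # ys" by (meson split_list)
    then have block: "sorted_wrt R (even_stage_block j)"
      using es by (simp add: sorted_wrt_append)
    have runs: "if even j then 1 \<in> set (down_run j) else 1 \<in> set (up_run j)"
      using j False by (auto simp: down_run_def up_run_def elim!: oddE)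
    have "if even j then R {1, 1 + 2, j, j + 1} (hinge j) else R (hinge j) {1, 1 + 2, j, j + 1}"
      using block runs unfolding even_stage_block_eq
      by (auto simp: sorted_wrt_append split: if_splits)
    moreover have "max j 4 = j" using False j by auto
    ultimately show ?thesis by (auto simp: numeral_3_eq_3 split: if_splits)
  qed
qed

text \<open>In a simple 4-polytope two vertices with three common facets span an edge.\<close>

abbreviation adjacent :: "nat set \<Rightarrow> nat set \<Rightarrow> bool" where
  "adjacent S T \<equiv> card (S \<inter> T) = 3"

text \<open>The statement about the last element is carried along because the induction appends
  at the end.\<close>

lemma parity_run:
  "successively (\<lambda>x y. y = x + 2) (filter (\<lambda>i. even i = p) [1..<k]) \<and>
   (filter (\<lambda>i. even i = p) [1..<k] \<noteq> [] \<longrightarrow>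
     (even (last (filter (\<lambda>i. even i = p) [1..<k])) = p \<and>
      last (filter (\<lambda>i. even i = p) [1..<k]) < k \<and> k \<le> last (filter (\<lambda>i. even i = p) [1..<k]) + 2))"
proof (induction k)
  case (Suc k)
  show ?case
  proof (cases "k = 0")
    case False
    let ?f = "filter (\<lambda>i. even i = p) [1..<k]"
    show ?thesis
    proof (cases "even k = p")
      case True
      have "k = last ?f + 2" if "?f \<noteq> []"
      proof -
        have "even (last ?f) = even k" "last ?f < k" "k \<le> last ?f + 2" using Suc that True by auto
        then show ?thesis by presburger
      qed
      then show ?thesis using Suc True False
        by (auto simp: successively_append_iff)
    next
      case False
      have "k \<noteq> last ?f + 2" if "?f \<noteq> []"
      proof
        assume "k = last ?f + 2"
        then have "even k = even (last ?f)" by presburger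
        then show False using Suc that False by simp
      qed
      then show ?thesis using Suc False \<open>k \<noteq> 0\<close>
        by (cases "?f = []") auto
    qed
  qed simp
qed simp

lemma last_filter_upt: "1 \<le> k \<Longrightarrow> P k \<Longrightarrow> last (filter P [1..<Suc k]) = k \<and> filter P [1..<Suc k] \<noteq> []"
  by simp

lemma adjacent_step:
  "i + 5 \<le> j \<Longrightarrow> adjacent {i, i + 2, j, j + 1} {i + 2, i + 2 + 2, j, j + 1}"
proof -
  assume "i + 5 \<le> j"
  then have "{i, i + 2, j, j + 1} \<inter> {i + 2, i + 2 + 2, j, j + 1} = {i + 2, j, j + 1}" by auto
  then show ?thesis using \<open>i + 5 \<le> j\<close> by simp
qed

lemma successively_valley:
  assumes "successively (\<lambda>x y. R (f y) (f x)) xs" "successively (\<lambda>x y. R (f x) (f y)) ys"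
    and "xs \<noteq> [] \<Longrightarrow> R (f (hd xs)) z" "ys \<noteq> [] \<Longrightarrow> R z (f (hd ys))"
  shows "successively R (map f (rev xs) @ [z] @ map f ys)"
  using assms
  by (cases "xs = []"; cases "ys = []")
    (simp_all add: successively_append_iff successively_map last_map last_rev hd_map
      successively_Cons)

text \<open>The first and last labels of a block are recorded for linking consecutive
  blocks.\<close>

lemma even_stage_block_adjacent:
  assumes j: "3 \<le> j"
  shows "successively adjacent (even_stage_block j)"
    and "hd (even_stage_block j) = (if j = 3 then hinge 3 else {j - 3, j - 3 + 2, j, j + 1})"
    and "last (even_stage_block j) = (if j \<le> 4 then hinge j else {j - 4, j - 4 + 2, j, j + 1})"
    and "even_stage_block j \<noteq> []"
proof -
  let ?f = "\<lambda>i. {i, i + 2, j, j + 1}"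
  have step: "adjacent (?f x) (?f y)" if "y = x + 2" "y + 3 \<le> j" for x y
    using adjacent_step[of x j] that by simp
  have step': "adjacent (?f y) (?f x)" if "y = x + 2" "y + 3 \<le> j" for x y
    using step[OF that] by (simp add: Int_commute)
  have "down_run j = filter (\<lambda>i. even i = odd j) [1..<j - 2]"
    by (auto simp: down_run_def intro: filter_cong)
  then have "successively (\<lambda>x y. y = x + 2) (down_run j)"
    using parity_run[of "odd j" "j - 2"] by simp
  then have d: "successively (\<lambda>x y. adjacent (?f y) (?f x)) (down_run j)"
  proof (rule successively_mono)
    fix x y assume "x \<in> set (down_run j)" "y \<in> set (down_run j)" "y = x + 2"
    then show "adjacent (?f y) (?f x)" by (intro step') (auto simp: down_run_def)
  qed
  have "successively (\<lambda>x y. y = x + 2) (up_run j)"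
    using parity_run[of "even j" "j - 3"] by (simp add: up_run_def)
  then have u: "successively (\<lambda>x y. adjacent (?f x) (?f y)) (up_run j)"
  proof (rule successively_mono)
    fix x y assume "x \<in> set (up_run j)" "y \<in> set (up_run j)" "y = x + 2"
    then show "adjacent (?f x) (?f y)" by (intro step) (auto simp: up_run_def)
  qed
  have hinge1: "adjacent (?f i) (hinge j)" if "i \<in> {1, 2}" "i + 3 \<le> j" for i
  proof -
    have "?f i \<inter> hinge j = {i, j, j + 1}" using that by auto
    then show ?thesis using that by simp
  qed
  have hd_run: "hd xs \<in> {1, 2}" if "xs = filter (\<lambda>i. even i = p) [1..<k]" "xs \<noteq> []" for xs p k
  proof -
    show ?thesis
    proof (cases "k \<le> 3")
      case True
      then have "set xs \<subseteq> {1, 2}" using that(1) by auto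
      then show ?thesis using that(2) hd_in_set by blast
    next
      case False
      then have "[1..<k] = 1 # 2 # [3..<k]" by (simp add: upt_conv_Cons numeral_eq_Suc)
      then show ?thesis using that(1) by auto
    qed
  qed
  have hd_down: "hd (down_run j) \<in> {1, 2}" if "down_run j \<noteq> []"
    using hd_run[OF \<open>down_run j = filter _ _\<close> that] .
  have hd_up: "hd (up_run j) \<in> {1, 2}" if "up_run j \<noteq> []"
    using hd_run[of "up_run j" "even j" "j - 3"] that by (simp add: up_run_def)
  have bd: "x + 3 \<le> j" if "x \<in> set (down_run j) \<union> set (up_run j)" for x
    using that by (auto simp: down_run_def up_run_def)
  show "successively adjacent (even_stage_block j)"
    unfolding even_stage_block_eq
  proof (rule successively_valley[where R = adjacent and f = "?f", OF d u])
    show "adjacent (?f (hd (down_run j))) (hinge j)" if "down_run j \<noteq> []"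
      by (intro hinge1 hd_down bd that UnI1 hd_in_set)
    show "adjacent (hinge j) (?f (hd (up_run j)))" if "up_run j \<noteq> []"
      unfolding Int_commute[of "hinge j"] by (intro hinge1 hd_up bd that UnI2 hd_in_set)
  qed
  show "even_stage_block j \<noteq> []" by (simp add: even_stage_block_eq)
  show "hd (even_stage_block j) = (if j = 3 then hinge 3 else {j - 3, j - 3 + 2, j, j + 1})"
  proof (cases "j = 3")
    case False
    then have "j - 2 = Suc (j - 3)" "1 \<le> j - 3" "even (j - 3) \<noteq> even j" using j by auto
    then have "last (down_run j) = j - 3" "down_run j \<noteq> []"
      unfolding down_run_def using last_filter_upt[of "j - 3" "\<lambda>i. even i \<noteq> even j"] by simp_all
    then show ?thesis using False by (simp add: even_stage_block_eq hd_append hd_map hd_rev)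
  qed (simp add: even_stage_block_def)
  show "last (even_stage_block j) = (if j \<le> 4 then hinge j else {j - 4, j - 4 + 2, j, j + 1})"
  proof (cases "j \<le> 4")
    case False
    then have "j - 3 = Suc (j - 4)" "1 \<le> j - 4" "even (j - 4) = even j" using j by auto
    then have "last (up_run j) = j - 4" "up_run j \<noteq> []"
      unfolding up_run_def using last_filter_upt[of "j - 4" "\<lambda>i. even i = even j"] by simp_all
    then show ?thesis using False by (simp add: even_stage_block_eq last_map)
  next
    case True
    then have "up_run j = []" by (simp add: up_run_def)
    then show ?thesis using True by (simp add: even_stage_block_eq)
  qed
qed

lemma block_link:
  assumes "3 \<le> j"
  shows "adjacent (last (even_stage_block j)) (hd (even_stage_block (Suc j)))"
proof -
  consider "j = 3" | "j = 4" | "5 \<le> j" using assms by linarith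
  then show ?thesis
  proof cases
    case 1
    have "hinge 3 \<inter> {1, 3, 4, 5} = {1, 3, 4}" by auto
    then show ?thesis using 1 by (simp add: even_stage_block_adjacent)
  next
    case 2
    have "hinge 4 \<inter> {2, 4, 5, 6} = {2, 4, 5}" by auto
    then show ?thesis using 2 by (simp add: even_stage_block_adjacent)
  next
    case 3
    then obtain k where k: "j = k + 5" by (metis add.commute le_Suc_ex)
    have "{k + 1, k + 3, k + 5, k + 6} \<inter> {k + 3, k + 5, k + 6, k + 7} = {k + 3, k + 5, k + 6}" by auto
    then show ?thesis using k by (simp add: even_stage_block_adjacent)
  qed
qed

lemma even_stage_adjacent:
  assumes "3 \<le> k"
  shows "successively adjacent (concat (map even_stage_block [3..<Suc k])) \<and>
    last (concat (map even_stage_block [3..<Suc k])) = last (even_stage_block k)"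
  using assms
proof (induction k rule: dec_induct)
  case base
  show ?case using even_stage_block_adjacent[of 3] by simp
next
  case (step k)
  have "[3..<Suc (Suc k)] = [3..<Suc k] @ [Suc k]" using step by simp
  then show ?case
    using step even_stage_block_adjacent[of "Suc k"] block_link[of k]
    by (simp add: successively_append_iff last_append del: upt_Suc)
qed

lemma pi_path_adjacent: "successively adjacent (pi_path m)"
proof -
  have "successively adjacent (odd_stage (m + 5))"
  proof -
    have "adjacent {Suc i, Suc i + 1, Suc i + 2, m + 5} {i, i + 1, i + 2, m + 5}" if "i + 3 < m + 5" for i
    proof -
      have "{Suc i, Suc i + 1, Suc i + 2, m + 5} \<inter> {i, i + 1, i + 2, m + 5} = {i + 1, i + 2, m + 5}"
        using that by auto
      then show ?thesis using that by simp
    qed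
    then show ?thesis
      unfolding odd_stage_def successively_map successively_rev
      by (auto simp: successively_conv_nth)
  qed
  moreover have "successively adjacent (even_stage m)"
    using even_stage_adjacent[of "m + 4"] by (simp add: eval_nat_numeral del: upt_Suc)
  moreover have "adjacent {1, 2, 3, m + 5} (hinge 3)"
  proof -
    have "{1, 2, 3, m + 5} \<inter> hinge 3 = {1, 2, 3}" by auto
    then show ?thesis by simp
  qed
  ultimately show ?thesis
    using odd_stage_last[of m] even_stage_first[of m]
    by (auto simp: pi_path_def successively_append_iff)
qed

section \<open>The cutting hyperplane\<close>

lemma tendsto_hyperbola:
  fixes c d k :: real
  assumes "k > 0"
  shows "((\<lambda>t. c / (t * k + d)) \<longlongrightarrow> 0) at_top"
proof -
  have "filterlim (\<lambda>t. t * k + d) at_top at_top"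
    using filterlim_tendsto_add_at_top[OF tendsto_const
        filterlim_tendsto_pos_mult_at_top[OF tendsto_const assms filterlim_ident], of d]
    by (simp add: mult.commute add.commute)
  then have "filterlim (\<lambda>t. t * k + d) at_infinity at_top"
    by (rule filterlim_at_top_imp_at_infinity)
  then show ?thesis by (rule tendsto_divide_0[OF tendsto_const])
qed

lemma eventually_hyperbola_less:
  fixes c d k :: real
  assumes "k > 0" "\<epsilon> > 0"
  shows "eventually (\<lambda>t. \<bar>c / (t * k + d) * h\<bar> < \<epsilon>) at_top"
proof -
  have "((\<lambda>t. \<bar>c / (t * k + d) * h\<bar>) \<longlongrightarrow> \<bar>0 * h\<bar>) at_top"
    using tendsto_hyperbola[OF assms(1)] by (intro tendsto_intros)
  then show ?thesis using assms(2) by (intro order_tendstoD) auto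
qed

lemma eventually_linear_greater:
  fixes c k :: real
  assumes "k > 0"
  shows "eventually (\<lambda>t. c < t * k) at_top"
proof -
  have "eventually (\<lambda>t. c / k < t) at_top" by (rule eventually_gt_at_top)
  then show ?thesis by eventually_elim (use assms in \<open>simp add: field_simps\<close>)
qed

text \<open>The choice of the cutting hyperplane, in terms of the values at the vertices:
  \<open>A\<close>, \<open>B\<close>, \<open>C\<close>, \<open>D\<close> are the slacks of
  facets 1, 2, 3 and \<open>n\<close>, \<open>H\<close> is the height, and \<open>W\<close> is
  the set of vertices to be cut off. On the polygon of facets 1 and 2 the function
  \<open>g\<close> is \<open>1 - la * C - mu * D\<close>, which is 1 at the vertex
  \<open>v\<close> and negative at all others once \<open>la\<close> and \<open>mu\<close> are
  large. The remaining two terms vanish on the polygon and are positive elsewhere, so large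
  \<open>al\<close> and \<open>be\<close> make \<open>g\<close> positive at the other vertices
  and draw the new vertices towards the cut ones. The parameters are chosen in the order
  \<open>mu\<close>, \<open>la\<close>, \<open>be\<close>, \<open>al\<close>, the last three
  each large in comparison with their predecessors. Since \<open>al\<close> comes last, the
  crossings on edges inside facet 2 (along which \<open>A\<close> grows) are closer to the cut
  vertex than those inside facet 1. The number \<open>\<tau> u z\<close> is the position of the
  zero of \<open>g\<close> on the edge from \<open>u\<close> to \<open>z\<close>.\<close>

lemma cut_parameters:
  fixes A B C D H :: "'v \<Rightarrow> real"
  assumes fin: "finite V"
    and nonneg: "\<And>z. z \<in> V \<Longrightarrow> 0 \<le> A z \<and> 0 \<le> B z \<and> 0 \<le> C z \<and> 0 \<le> D z"
    and W: "W = {z \<in> V. A z = 0 \<and> B z = 0} - {v}"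
    and v: "A v = 0" "B v = 0" "C v = 0" "D v = 0"
    and w: "w \<in> W" "C w = 0" "D w > 0"
    and w': "w' \<in> W" "C w' > 0" "D w' = 0"
    and W_pos: "\<And>z. z \<in> W \<Longrightarrow> z \<noteq> w \<Longrightarrow> C z > 0"
    and H_inj: "inj_on H V" and H_v: "H v < H w"
    and eps: "\<epsilon> > 0"
  shows "\<exists>al be la mu g \<tau>.
    (\<forall>z. g z = al * A z + be * B z - la * C z - mu * D z + 1) \<and>
    (\<forall>u z. \<tau> u z = - g u / (g z - g u)) \<and>
    (\<forall>z\<in>W. g z < 0) \<and> (\<forall>z\<in>V - W. g z > 0) \<and> g w = -1 \<and>
    H w' + \<tau> w' v * (H v - H w') < (H v + H w) / 2 \<and>
    (\<forall>u\<in>W. \<forall>z\<in>V. A z = 0 \<longrightarrow> B z > 0 \<longrightarrow> \<bar>\<tau> u z * (H z - H u)\<bar> < \<epsilon>) \<and>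
    (\<forall>u\<in>W. \<forall>z\<in>V. \<forall>z'\<in>V. A z > 0 \<longrightarrow> B z = 0 \<longrightarrow> A z' = 0 \<longrightarrow> B z' > 0 \<longrightarrow>
       \<bar>\<tau> u z * (H z - H u)\<bar> < \<bar>\<tau> u z' * (H z' - H u)\<bar>)"
proof -
  have WV: "W \<subseteq> V" using W by auto
  then have finW: "finite W" using fin finite_subset by blast
  \<comment> \<open>This value puts the zero of \<open>g\<close> at the midpoint of the edge from \<open>w\<close> to \<open>v\<close>.\<close>
  define mu where "mu = 2 / D w"
  have mu: "mu * D w = 2" "mu > 0" using w by (simp_all add: mu_def)
  have "eventually (\<lambda>la. \<forall>z\<in>W - {w}. 1 < la * C z) at_top"
    using finW W_pos by (intro eventually_ball_finite) (auto intro!: eventually_linear_greater)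
  moreover have "eventually (\<lambda>la. \<bar>(H w' - H v) / (la * C w' + 0) * 1\<bar> < (H w - H v) / 2) at_top"
    using w' H_v by (intro eventually_hyperbola_less) auto
  ultimately have "eventually (\<lambda>la. (\<forall>z\<in>W - {w}. 1 < la * C z) \<and>
      \<bar>(H w' - H v) / (la * C w' + 0) * 1\<bar> < (H w - H v) / 2) at_top"
    by (rule eventually_conj)
  then obtain la where la: "\<And>z. z \<in> W \<Longrightarrow> z \<noteq> w \<Longrightarrow> 1 < la * C z"
      "\<bar>(H w' - H v) / (la * C w')\<bar> < (H w - H v) / 2"
    using eventually_happens'[OF trivial_limit_at_top_linorder] by force
  \<comment> \<open>On \<open>W\<close> this is the amount \<open>- g\<close> by which a vertex is cut off; it does not involve \<open>al\<close> and \<open>be\<close>.\<close>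
  define b where "b z = la * C z + mu * D z - 1" for z
  have b_pos: "b u > 0" if "u \<in> W" for u
  proof (cases "u = w")
    case True
    then show ?thesis using mu w by (simp add: b_def)
  next
    case False
    have "0 \<le> mu * D u" using nonneg[of u] that WV mu by auto
    then show ?thesis using la(1)[OF that False] by (simp add: b_def)
  qed
  have "eventually (\<lambda>be. \<forall>z\<in>{z\<in>V. B z > 0}. b z < be * B z) at_top"
    using fin by (intro eventually_ball_finite) (auto intro!: eventually_linear_greater)
  moreover have "eventually (\<lambda>be. \<forall>u\<in>W. \<forall>z\<in>{z\<in>V. B z > 0}.
      \<bar>b u / (be * B z + (b u - b z)) * (H z - H u)\<bar> < \<epsilon>) at_top"
    using fin finW eps
    by (intro eventually_ball_finite ballI eventually_hyperbola_less) auto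
  ultimately have "eventually (\<lambda>be. be \<ge> 0 \<and> (\<forall>z\<in>{z\<in>V. B z > 0}. b z < be * B z) \<and>
      (\<forall>u\<in>W. \<forall>z\<in>{z\<in>V. B z > 0}. \<bar>b u / (be * B z + (b u - b z)) * (H z - H u)\<bar> < \<epsilon>)) at_top"
    using eventually_ge_at_top[of "0 :: real"] by eventually_elim auto
  then obtain be where be: "be \<ge> 0" "\<And>z. z \<in> V \<Longrightarrow> B z > 0 \<Longrightarrow> b z < be * B z"
      "\<And>u z. u \<in> W \<Longrightarrow> z \<in> V \<Longrightarrow> B z > 0 \<Longrightarrow>
        \<bar>b u / (be * B z + (b u - b z)) * (H z - H u)\<bar> < \<epsilon>"
    using eventually_happens'[OF trivial_limit_at_top_linorder] by force
  define drop where "drop u z = \<bar>b u / (be * B z + (b u - b z)) * (H z - H u)\<bar>" for u z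
  have drop_pos: "0 < drop u z" if "u \<in> W" "z \<in> V" "B z > 0" for u z
  proof -
    have "z \<noteq> u" using that W by auto
    then have "H z - H u \<noteq> 0" using H_inj that WV by (auto simp: inj_on_def)
    then show ?thesis using b_pos[OF that(1)] be(2)[OF that(2,3)] by (simp add: drop_def)
  qed
  have "eventually (\<lambda>al. \<forall>z\<in>{z\<in>V. A z > 0}. b z < al * A z) at_top"
    using fin by (intro eventually_ball_finite) (auto intro!: eventually_linear_greater)
  moreover have "eventually (\<lambda>al. \<forall>u\<in>W. \<forall>z\<in>{z\<in>V. A z > 0}. \<forall>z'\<in>{z\<in>V. B z > 0}.
      \<bar>b u / (al * A z + (b u - b z)) * (H z - H u)\<bar> < drop u z') at_top"
    using fin finW drop_pos
    by (intro eventually_ball_finite ballI eventually_hyperbola_less) auto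
  ultimately have "eventually (\<lambda>al. (\<forall>z\<in>{z\<in>V. A z > 0}. b z < al * A z) \<and>
      (\<forall>u\<in>W. \<forall>z\<in>{z\<in>V. A z > 0}. \<forall>z'\<in>{z\<in>V. B z > 0}.
      \<bar>b u / (al * A z + (b u - b z)) * (H z - H u)\<bar> < drop u z')) at_top"
    by (rule eventually_conj)
  then obtain al where al: "\<And>z. z \<in> V \<Longrightarrow> A z > 0 \<Longrightarrow> b z < al * A z"
      "\<And>u z z'. u \<in> W \<Longrightarrow> z \<in> V \<Longrightarrow> A z > 0 \<Longrightarrow> z' \<in> V \<Longrightarrow> B z' > 0 \<Longrightarrow>
        \<bar>b u / (al * A z + (b u - b z)) * (H z - H u)\<bar> < drop u z'"
    using eventually_happens'[OF trivial_limit_at_top_linorder] by force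
  define g where "g z = al * A z + be * B z - la * C z - mu * D z + 1" for z
  have g: "g z = al * A z + be * B z - b z" for z by (simp add: g_def b_def)
  have gW: "g u = - b u" if "u \<in> W" for u using that W by (simp add: g)
  define \<tau> where "\<tau> u z = - g u / (g z - g u)" for u z
  have tA: "\<tau> u z = b u / (al * A z + (b u - b z))" if "u \<in> W" "B z = 0" for u z
    using that by (simp add: \<tau>_def gW g[of z] algebra_simps)
  have tB: "\<tau> u z = b u / (be * B z + (b u - b z))" if "u \<in> W" "A z = 0" for u z
    using that by (simp add: \<tau>_def gW g[of z] algebra_simps)
  show ?thesis
  proof (rule exI[of _ al], rule exI[of _ be], rule exI[of _ la], rule exI[of _ mu],
      rule exI[of _ g], rule exI[of _ \<tau>], intro conjI ballI impI)
    show "g z < 0" if "z \<in> W" for z using gW b_pos that by simp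
    show "g z > 0" if z: "z \<in> V - W" for z
    proof -
      consider "z = v" | "A z > 0" | "A z = 0" "B z > 0"
        using z nonneg[of z] W by (cases "A z = 0"; cases "B z = 0") auto
      then show ?thesis
      proof cases
        case 2
        moreover have "0 \<le> be * B z" using be(1) nonneg[of z] z by simp
        ultimately show ?thesis using al(1)[of z] z by (simp add: g)
      next
        case 3
        then show ?thesis using be(2)[of z] z by (simp add: g)
      qed (simp add: g_def v)
    qed
    show "g w = -1" using gW[OF w(1)] mu w by (simp add: b_def)
    show "H w' + \<tau> w' v * (H v - H w') < (H v + H w) / 2"
    proof -
      have "w' \<noteq> w" using w w' by auto
      then have k: "la * C w' > 1" using la w' by blast
      have tau: "\<tau> w' v = (la * C w' - 1) / (la * C w')"
      proof -
        have "g w' = 1 - la * C w'" using gW[OF w'(1)] w'(3) by (simp add: b_def)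
        moreover have "g v = 1" using v by (simp add: g_def)
        ultimately show ?thesis by (simp add: \<tau>_def)
      qed
      have "H w' + \<tau> w' v * (H v - H w') = H v + (H w' - H v) / (la * C w')"
      proof -
        have "H w' + (K - 1) / K * (H v - H w') = H v + (H w' - H v) / K" if "K > 1" for K
          using that by (simp add: field_simps)
        from this[OF k] show ?thesis using tau by simp
      qed
      also have "\<dots> < H v + (H w - H v) / 2" using la(2) by linarith
      finally show ?thesis by (simp add: field_simps)
    qed
    show "\<bar>\<tau> u z * (H z - H u)\<bar> < \<epsilon>" if "u \<in> W" "z \<in> V" "A z = 0" "B z > 0" for u z
      using be(3) that tB by simp
    show "\<bar>\<tau> u z * (H z - H u)\<bar> < \<bar>\<tau> u z' * (H z' - H u)\<bar>"
      if "u \<in> W" "z \<in> V" "z' \<in> V" "A z > 0" "B z = 0" "A z' = 0" "B z' > 0" for u z z'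
      using al(2)[of u z z'] that tB[of u z'] tA[of u z] by (simp add: drop_def)
  qed (simp_all add: g_def \<tau>_def)
qed

section \<open>Realizations as systems of inequalities\<close>

lemma polyh_reindex: "polyh (f ` I) a b = polyh I (a \<circ> f) (b \<circ> f)"
  by (auto simp: polyh_def)

lemma tight_reindex: "tight (f ` I) a b x = f ` tight I (a \<circ> f) (b \<circ> f) x"
  by (auto simp: tight_def)

lemma simple_system_reindex:
  assumes "simple_system I (a \<circ> f) (b \<circ> f)" "inj_on f I"
  shows "simple_system (f ` I) a b"
proof -
  interpret simple_system I "a \<circ> f" "b \<circ> f" by fact
  show ?thesis
  proof
    show "finite (f ` I)" using finI by simp
    show "bounded (polyh (f ` I) a b)" using bnd by (simp add: polyh_reindex)
    fix x assume "x extreme_point_of polyh (f ` I) a b"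
    then have "card (L x) = DIM('b)" using simple by (simp add: polyh_reindex)
    moreover have "card (f ` L x) = card (L x)"
      using assms(2) by (intro card_image) (auto simp: tight_def inj_on_def)
    ultimately show "card (tight (f ` I) a b x) = DIM('b)" by (simp add: tight_reindex)
  qed
qed

definition facet_family :: "nat \<Rightarrow> (nat \<Rightarrow> real ^ 4) \<Rightarrow> (nat \<Rightarrow> real) \<Rightarrow> nat \<Rightarrow> (real ^ 4) set" where
  "facet_family m a b i = {x \<in> polyh {1..m + 5} a b. a i \<bullet> x = b i}"

lemma label_set_facet_family:
  "v \<in> polyh {1..m + 5} a b \<Longrightarrow> label_set m (facet_family m a b) v = tight {1..m + 5} a b v"
  by (auto simp: label_set_def facet_family_def tight_def)

lemma label_bij:
  "bij_betw (label_set m (facet_family m a b)) {v. v extreme_point_of polyh {1..m + 5} a b} A \<longleftrightarrow>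
   bij_betw (tight {1..m + 5} a b) {v. v extreme_point_of polyh {1..m + 5} a b} A"
  by (rule bij_betw_cong) (auto simp: label_set_facet_family extreme_point_of_def)

text \<open>For a simple system of inequalities it is enough to know the tight sets of the
  vertices; the facets and their labels follow because every index occurs in some label
  set.\<close>

lemma realization_of_system:
  fixes a :: "nat \<Rightarrow> real ^ 4"
  assumes "simple_system {1..m + 5} a b"
    and bij: "bij_betw (tight {1..m + 5} a b) {v. v extreme_point_of polyh {1..m + 5} a b} (Q_vertices m)"
  shows "realization m (polyh {1..m + 5} a b) (facet_family m a b)"
proof -
  interpret simple_system "{1..m + 5}" a b by fact
  have cover: "\<exists>v. v extreme_point_of P \<and> i \<in> L v" if i: "i \<in> {1..m + 5}" for i
  proof -
    obtain S where "S \<in> Q_vertices m" "i \<in> S" using Q_vertices_cover[OF i] by blast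
    moreover have "S \<in> L ` {v. v extreme_point_of P}"
      using bij \<open>S \<in> Q_vertices m\<close> by (simp add: bij_betw_def)
    ultimately show ?thesis by blast
  qed
  have "polytope P"
    using bnd polyhedron_polyh[of "{1..m + 5}"] by (simp add: polytope_eq_bounded_polyhedron)
  moreover have "aff_dim P = 4"
    using facets(1)[OF _ cover] by simp
  moreover have "bij_betw (facet_family m a b) {1..m + 5} {C. C facet_of P}"
  proof -
    have "facet_family m a b = (\<lambda>i. {x\<in>P. a i \<bullet> x = b i})" by (simp add: facet_family_def fun_eq_iff)
    then show ?thesis using facets(2)[OF _ cover] by simp
  qed
  ultimately show ?thesis unfolding realization_def label_bij using bij by blast
qed

lemma system_of_realization:
  assumes "realization m P F"
  obtains a b where "P = polyh {1..m + 5} a b" "\<And>i. i \<in> {1..m + 5} \<Longrightarrow> F i = facet_family m a b i"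
    "simple_system {1..m + 5} a b"
    "bij_betw (tight {1..m + 5} a b) {v. v extreme_point_of polyh {1..m + 5} a b} (Q_vertices m)"
proof -
  have P: "polytope P" "aff_dim P = 4" "bij_betw F {1..m + 5} {C. C facet_of P}"
    and bij: "bij_betw (label_set m F) {v. v extreme_point_of P} (Q_vertices m)"
    using assms by (auto simp: realization_def)
  have "affine hull P = UNIV" using P(2) by (simp flip: aff_dim_eq_full)
  then obtain a b where ab: "P = polyh {1..m + 5} a b"
      "\<forall>i\<in>{1..m + 5}. F i = {x\<in>P. a i \<bullet> x = b i}"
    using facet_inequalities[OF polytope_imp_polyhedron[OF P(1)] _ P(3)] by blast
  then have F: "F i = facet_family m a b i" if "i \<in> {1..m + 5}" for i
    using that by (simp add: facet_family_def)
  then have "label_set m F = label_set m (facet_family m a b)"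
    by (auto simp: label_set_def fun_eq_iff)
  then have bij': "bij_betw (tight {1..m + 5} a b) {v. v extreme_point_of polyh {1..m + 5} a b} (Q_vertices m)"
    using bij label_bij[of m a b] ab(1) by simp
  have "simple_system {1..m + 5} a b"
  proof
    show "bounded (polyh {1..m + 5} a b)" using P(1) ab(1) by (simp add: polytope_imp_bounded)
    fix x assume "x extreme_point_of polyh {1..m + 5} a b"
    then have "tight {1..m + 5} a b x \<in> Q_vertices m" using bij' by (auto simp: bij_betw_def)
    then show "card (tight {1..m + 5} a b x) = DIM(real ^ 4)" using Q_vertices_card by simp
  qed simp
  then show thesis using that ab(1) F bij' by blast
qed

text \<open>Monotonicity is all that has to be checked for the path: the edges are present
  because consecutive label sets share three elements, and strictly increasing heights make the
  vertices distinct.\<close>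

lemma pi_monotone_of_system:
  fixes a :: "nat \<Rightarrow> real ^ 4"
  assumes sys: "simple_system {1..m + 5} a b"
    and bij: "bij_betw (tight {1..m + 5} a b) {v. v extreme_point_of polyh {1..m + 5} a b} (Q_vertices m)"
    and X: "\<And>S. S \<in> Q_vertices m \<Longrightarrow> X S extreme_point_of polyh {1..m + 5} a b \<and> tight {1..m + 5} a b (X S) = S"
    and sorted: "sorted_wrt (\<lambda>S T. X S $ 4 < X T $ 4) (pi_path m)"
  shows "pi_monotone m (polyh {1..m + 5} a b) (facet_family m a b)"
proof -
  interpret simple_system "{1..m + 5}" a b by fact
  let ?vs = "map X (pi_path m)"
  have sorted': "sorted_wrt (\<lambda>v w. v $ 4 < w $ 4) ?vs"
    using sorted by (simp add: sorted_wrt_map)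
  have "distinct ?vs"
  proof -
    have "sorted_wrt (<) (map (\<lambda>v. v $ 4) ?vs)" using sorted' by (simp add: sorted_wrt_map)
    then have "distinct (map (\<lambda>v. v $ 4) ?vs)" using strict_sorted_iff by blast
    then show ?thesis using distinct_map by blast
  qed
  moreover have "set ?vs = {v. v extreme_point_of P}"
  proof (intro equalityI subsetI)
    fix v assume "v \<in> {v. v extreme_point_of P}"
    then have v: "v extreme_point_of P" by simp
    then have "L v \<in> Q_vertices m" using bij by (auto simp: bij_betw_def)
    moreover from this have "v = X (L v)" using X tight_inj[OF v] by simp
    ultimately show "v \<in> set ?vs" by (auto simp: set_pi_path)
  qed (use X in \<open>auto simp: set_pi_path\<close>)
  moreover have "closed_segment (?vs ! k) (?vs ! Suc k) edge_of P" if k: "Suc k < length ?vs" for k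
  proof -
    let ?S = "pi_path m ! k" and ?T = "pi_path m ! Suc k"
    have "card (?S \<inter> ?T) = 3" using successively_nth[OF pi_path_adjacent] k by simp
    moreover have "?S \<in> Q_vertices m" "?T \<in> Q_vertices m"
      using k by (auto simp flip: set_pi_path)
    moreover have "?S \<noteq> ?T" using \<open>distinct ?vs\<close> k by (auto simp: distinct_map nth_eq_iff_index_eq)
    moreover have "X ?S \<noteq> X ?T" using calculation X by metis
    ultimately have "closed_segment (X ?S) (X ?T) edge_of P"
      using X by (intro edge_segment) auto
    then show ?thesis using k by simp
  qed
  ultimately have "hamilton_path P ?vs" by (simp add: hamilton_path_def)
  moreover have "map (label_set m (facet_family m a b)) ?vs = pi_path m"
  proof -
    have "label_set m (facet_family m a b) (X S) = S" if "S \<in> set (pi_path m)" for S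
      using X[of S] that label_set_facet_family in_P by (simp add: set_pi_path)
    then show ?thesis by (simp add: map_idI)
  qed
  ultimately show ?thesis using sorted' unfolding pi_monotone_def by blast
qed

lemma system_of_pi_monotone:
  assumes "realization m P F" "pi_monotone m P F"
  obtains a b X where "P = polyh {1..m + 5} a b" "simple_system {1..m + 5} a b"
    "bij_betw (tight {1..m + 5} a b) {v. v extreme_point_of polyh {1..m + 5} a b} (Q_vertices m)"
    "\<forall>S\<in>Q_vertices m. X S extreme_point_of polyh {1..m + 5} a b \<and> tight {1..m + 5} a b (X S) = S"
    "sorted_wrt (\<lambda>S T. X S $ 4 < X T $ 4) (pi_path m)"
proof -
  obtain a b where ab: "P = polyh {1..m + 5} a b" "\<And>i. i \<in> {1..m + 5} \<Longrightarrow> F i = facet_family m a b i"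
    and sys: "simple_system {1..m + 5} a b"
    and bij: "bij_betw (tight {1..m + 5} a b) {v. v extreme_point_of polyh {1..m + 5} a b} (Q_vertices m)"
    using system_of_realization[OF assms(1)] by blast
  obtain vs where vs: "hamilton_path P vs" "map (label_set m F) vs = pi_path m"
      "sorted_wrt (\<lambda>v w. v $ 4 < w $ 4) vs"
    using assms(2) by (auto simp: pi_monotone_def)
  let ?E = "{v. v extreme_point_of polyh {1..m + 5} a b}"
  have ext: "set vs = ?E" using vs(1) ab(1) by (simp add: hamilton_path_def)
  have "label_set m F v = tight {1..m + 5} a b v" if "v \<in> ?E" for v
  proof -
    have "label_set m F v = label_set m (facet_family m a b) v" using ab(2) by (auto simp: label_set_def)
    then show ?thesis using that label_set_facet_family by (simp add: extreme_point_of_def)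
  qed
  then have path: "map (tight {1..m + 5} a b) vs = pi_path m"
    using vs(2) ext by (metis map_cong)
  define X where "X = inv_into ?E (tight {1..m + 5} a b)"
  have X: "X (tight {1..m + 5} a b v) = v" if "v \<in> ?E" for v
    using bij that unfolding X_def by (intro inv_into_f_f) (auto simp: bij_betw_def)
  show thesis
  proof (rule that[of a b X, OF ab(1) sys bij])
    show "\<forall>S\<in>Q_vertices m. X S extreme_point_of polyh {1..m + 5} a b \<and> tight {1..m + 5} a b (X S) = S"
    proof
      fix S assume "S \<in> Q_vertices m"
      then have "S \<in> tight {1..m + 5} a b ` ?E" using bij by (simp add: bij_betw_def)
      then obtain v where "v \<in> ?E" "S = tight {1..m + 5} a b v" by (rule imageE)
      then show "X S extreme_point_of polyh {1..m + 5} a b \<and> tight {1..m + 5} a b (X S) = S"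
        using X[of v] by simp
    qed
    show "sorted_wrt (\<lambda>S T. X S $ 4 < X T $ 4) (pi_path m)"
      unfolding path[symmetric] sorted_wrt_map
      by (rule sorted_wrt_mono_rel[OF _ vs(3)]) (use X ext in auto)
  qed
qed

section \<open>The inductive step\<close>

text \<open>Stated through membership of 1 and 2, which for a vertex means that the slacks of
  facets 1 and 2 vanish; this is the form in which the choice of the hyperplane needs the cut
  vertices.\<close>

definition hinges :: "nat \<Rightarrow> nat set set" where
  "hinges m = {S \<in> Q_vertices m. 1 \<in> S \<and> 2 \<in> S} - {{1, 2, 3, m + 5}}"

lemma hinge_in_hinges:
  assumes "3 \<le> j" "j \<le> m + 4"
  shows "hinge j \<in> hinges m"
proof -
  have "hinge j \<noteq> {1, 2, 3, m + 5}"
  proof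
    assume eq: "hinge j = {1, 2, 3, m + 5}"
    then have "j \<in> {1, 2, 3, m + 5}" "j + 1 \<in> {1, 2, 3, m + 5}" by blast+
    then show False using assms by auto
  qed
  then show ?thesis using hinge_in_Q[OF assms] by (simp add: hinges_def)
qed

lemma hingesE:
  assumes "S \<in> hinges m"
  obtains j where "3 \<le> j" "j \<le> m + 4" "S = hinge j"
proof -
  have "S \<in> Q_vertices m" "1 \<in> S" "2 \<in> S" "S \<noteq> {1, 2, 3, m + 5}"
    using assms by (auto simp: hinges_def)
  then show ?thesis by (metis Q_both_1_2 that)
qed

text \<open>An edge from a cut vertex to a kept one either leaves facet 1 or facet 2, or it is
  one of the two polygon edges at \<open>{1, 2, 3, n}\<close>; in each case the label set of its
  crossing point is one of the next type.\<close>

lemma cut_edge_label: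
  assumes S: "S \<in> hinges m" and T: "T \<in> Q_vertices m" "T \<notin> hinges m" and card: "card (S \<inter> T) = 3"
  shows "insert 1 (Suc ` (S \<inter> T)) \<in> Q_vertices (Suc m)"
proof -
  obtain j where j: "3 \<le> j" "j \<le> m + 4" "S = hinge j" using S by (rule hingesE)
  show ?thesis
  proof (cases "1 \<in> T \<and> 2 \<in> T")
    case True
    then have T_eq: "T = {1, 2, 3, m + 5}" using T by (auto simp: hinges_def)
    consider "j = 3" | "j = m + 4" | "j \<noteq> 3" "j \<noteq> m + 4" by blast
    then show ?thesis
    proof cases
      case 1
      then have "S \<inter> T = {1, 2, 3}" using j T_eq by auto
      then show ?thesis using new_labels_in_Q(2)[of m] by (simp add: eval_nat_numeral insert_commute)
    next
      case 2
      then have "S \<inter> T = {1, 2, m + 5}" using j T_eq by auto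
      then show ?thesis using new_labels_in_Q(1)[of m] by (simp add: eval_nat_numeral insert_commute)
    next
      case 3
      then have "S \<inter> T = {1, 2}" using j T_eq by auto
      then show ?thesis using card by simp
    qed
  next
    case False
    then consider "1 \<notin> T" | "2 \<notin> T" by blast
    then show ?thesis
    proof cases
      case 1
      then have sub: "S \<inter> T \<subseteq> {2, j, j + 1}" using j by auto
      have "S \<inter> T = {2, j, j + 1}"
        by (rule card_subset_eq[OF _ sub]) (use card j in auto)
      then show ?thesis using new_labels_in_Q(3)[of j m] j by (simp add: eval_nat_numeral)
    next
      case 2
      then have sub: "S \<inter> T \<subseteq> {1, j, j + 1}" using j by auto
      have "S \<inter> T = {1, j, j + 1}"
        by (rule card_subset_eq[OF _ sub]) (use card j in auto)
      then show ?thesis using new_labels_in_Q(4)[of j m] j by (simp add: eval_nat_numeral)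
    qed
  qed
qed

lemma odd_stage_not_hinge:
  assumes "S \<in> set (odd_stage (m + 5))"
  shows "S \<in> Q_vertices m - hinges m"
proof -
  obtain i where i: "S = {i, i + 1, i + 2, m + 5}" "1 \<le> i" "i \<le> m + 2"
    using assms by (auto simp: odd_stage_def)
  have "S = {1, 2, 3, m + 5}" if "1 \<in> S"
  proof -
    have "i = 1" using that i by auto
    then show ?thesis using i by (simp add: eval_nat_numeral)
  qed
  then have "S \<notin> hinges m" by (auto simp: hinges_def)
  then show ?thesis using Q_type2aI i by simp
qed

lemma finite_gap:
  fixes A :: "real set"
  assumes "finite A"
  shows "\<exists>\<epsilon>>0. \<forall>x\<in>A. \<forall>y\<in>A. x < y \<longrightarrow> x + 2 * \<epsilon> \<le> y"
proof -
  define D where "D = insert 1 ((\<lambda>(x, y). y - x) ` {(x, y). x \<in> A \<and> y \<in> A \<and> x < y})"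
  have "finite {(x, y). x \<in> A \<and> y \<in> A \<and> x < y}"
    by (rule finite_subset[of _ "A \<times> A"]) (use assms in auto)
  then have D: "finite D" "D \<noteq> {}" "\<forall>d\<in>D. d > 0" by (auto simp: D_def)
  then have "Min D > 0" by simp
  moreover have "x + 2 * (Min D / 2) \<le> y" if "x \<in> A" "y \<in> A" "x < y" for x y
  proof -
    have "y - x \<in> D" using that by (auto simp: D_def)
    then show ?thesis using Min_le[OF D(1)] by fastforce
  qed
  ultimately show ?thesis by (intro exI[of _ "Min D / 2"]) auto
qed

text \<open>Clusters within \<open>\<epsilon>\<close> of points that are
  \<open>2 * \<epsilon>\<close> apart cannot interleave.\<close>

lemma sorted_wrt_refine:
  fixes h :: "'a \<Rightarrow> real" and h' :: "'b \<Rightarrow> real"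
  assumes "sorted_wrt (\<lambda>x y. h x + 2 * \<epsilon> \<le> h y) xs"
    and "\<And>x. x \<in> set xs \<Longrightarrow> sorted_wrt (\<lambda>y z. h' y < h' z) (f x)"
    and "\<And>x y. x \<in> set xs \<Longrightarrow> y \<in> set (f x) \<Longrightarrow> \<bar>h' y - h x\<bar> < \<epsilon>"
  shows "sorted_wrt (\<lambda>y z. h' y < h' z) (concat (map f xs))"
  using assms
proof (induction xs)
  case (Cons x xs)
  have "h' y < h' z" if "y \<in> set (f x)" "x' \<in> set xs" "z \<in> set (f x')" for y x' z
  proof -
    have "\<bar>h' y - h x\<bar> < \<epsilon>" "\<bar>h' z - h x'\<bar> < \<epsilon>" "h x + 2 * \<epsilon> \<le> h x'"
      using Cons.prems that by auto
    then show ?thesis by linarith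
  qed
  then show ?case using Cons by (auto simp: sorted_wrt_append)
qed simp

text \<open>The cut removes all vertices of the polygon of facets 1 and 2 except
  \<open>{1, 2, 3, n}\<close>, and the new facet gets label 1. Heights of the new vertices are
  controlled by \<open>cut_parameters\<close>: the two on the polygon lie between the old
  vertices \<open>{1, 2, 3, n}\<close> and \<open>{1, 2, 3, 4}\<close> in the right order; all
  others are within \<open>\<epsilon>\<close> of the hinge vertex from which they arise. Of the
  two new vertices at a hinge, the one on the edge inside facet 1 is further away, so it decides
  their order, and it lies on the side given by \<open>pi_path_hinge_order\<close>.\<close>

lemma inductive_step:
  assumes real: "realization m P F" and mono: "pi_monotone m P F"
  shows "\<exists>P' F'. obtained_by_cut P P' \<and> realization (Suc m) P' F' \<and> pi_monotone (Suc m) P' F'"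
proof -
  obtain a b X where P_eq: "P = polyh {1..m + 5} a b" and sys: "simple_system {1..m + 5} a b"
    and bij: "bij_betw (tight {1..m + 5} a b) {v. v extreme_point_of polyh {1..m + 5} a b} (Q_vertices m)"
    and X_all: "\<forall>S\<in>Q_vertices m. X S extreme_point_of polyh {1..m + 5} a b \<and> tight {1..m + 5} a b (X S) = S"
    and sorted: "sorted_wrt (\<lambda>S T. X S $ 4 < X T $ 4) (pi_path m)"
    using system_of_pi_monotone[OF real mono] .
  have X: "X S extreme_point_of polyh {1..m + 5} a b \<and> tight {1..m + 5} a b (X S) = S" if "S \<in> Q_vertices m" for S
    using X_all that by (rule bspec)
  interpret old: simple_system "{1..m + 5}" a b by (rule sys)
  let ?I = "{1..m + 5}"
  \<comment> \<open>Heights and slacks are transported to labels, where the combinatorics lives.\<close>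
  define H where "H S = X S $ 4" for S
  define f where "f i S = a i \<bullet> X S - b i" for i S
  have f_zero: "f i S = 0 \<longleftrightarrow> i \<in> S" if "S \<in> Q_vertices m" "i \<in> ?I" for i S
  proof -
    have "i \<in> S \<longleftrightarrow> i \<in> old.L (X S)" using X that by simp
    then show ?thesis using that by (simp add: tight_def f_def)
  qed
  have f_nonneg: "0 \<le> f i S" if "S \<in> Q_vertices m" "i \<in> ?I" for i S
    using X[OF that(1)] old.in_P that(2) by (auto simp: polyh_def f_def)
  have f_pos: "0 < f i S" if "S \<in> Q_vertices m" "i \<in> ?I" "i \<notin> S" for i S
    using f_zero[OF that(1,2)] f_nonneg[OF that(1,2)] that(3) by force
  have mem: "1 \<in> ?I" "2 \<in> ?I" "3 \<in> ?I" "m + 5 \<in> ?I" by auto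
  define v where "v = {1, 2, 3, m + 5}"
  define w where "w = hinge 3"
  define w' where "w' = hinge (m + 4)"
  have vQ: "v \<in> Q_vertices m" using Q_type2aI[of 1 m] by (simp add: v_def eval_nat_numeral)
  have f_v: "f 1 v = 0" "f 2 v = 0" "f 3 v = 0" "f (m + 5) v = 0"
    using f_zero[OF vQ] mem by (simp_all add: v_def)
  have wW: "w \<in> hinges m" and w'W: "w' \<in> hinges m"
    using hinge_in_hinges[of 3 m] hinge_in_hinges[of "m + 4" m] by (simp_all add: w_def w'_def)
  have WQ: "hinges m \<subseteq> Q_vertices m" and vW: "v \<notin> hinges m" by (auto simp: hinges_def v_def)
  have path_lt: "sorted_wrt (\<lambda>S T. H S < H T) (pi_path m)" using sorted by (simp add: H_def)
  have H_inj: "inj_on H (Q_vertices m)"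
  proof -
    have "sorted_wrt (<) (map H (pi_path m))" using path_lt by (simp add: sorted_wrt_map)
    then have "distinct (map H (pi_path m))" using strict_sorted_iff by blast
    then show ?thesis by (simp add: distinct_map set_pi_path)
  qed
  obtain os where os: "odd_stage (m + 5) = os @ [v]" using odd_stage_last v_def by blast
  obtain es where es: "even_stage m = w # es" using even_stage_first w_def by blast
  have odd_even: "H S < H T" if "S \<in> set (odd_stage (m + 5))" "T \<in> set (even_stage m)" for S T
    using path_lt that unfolding pi_path_def sorted_wrt_append by blast
  have v_even: "H v < H T" if "T \<in> set (even_stage m)" for T
    using odd_even[of v T] that os by simp
  have H_vw: "H v < H w" using v_even es by simp
  have H_vw': "H v < H w'"
  proof -
    have "w' \<in> set (even_stage_block (m + 4))" by (simp add: w'_def set_even_stage_block)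
    then have "w' \<in> set (even_stage m)" by force
    then show ?thesis by (rule v_even)
  qed
  obtain \<epsilon> where eps: "\<epsilon> > 0"
    and gap: "\<And>S T. S \<in> Q_vertices m \<Longrightarrow> T \<in> Q_vertices m \<Longrightarrow> H S < H T \<Longrightarrow> H S + 2 * \<epsilon> \<le> H T"
    using finite_gap[of "H ` Q_vertices m"] finite_Q_vertices by blast
  have "\<exists>al be la mu g \<tau>.
    (\<forall>S. g S = al * f 1 S + be * f 2 S - la * f 3 S - mu * f (m + 5) S + 1) \<and>
    (\<forall>u z. \<tau> u z = - g u / (g z - g u)) \<and>
    (\<forall>S\<in>hinges m. g S < 0) \<and> (\<forall>S\<in>Q_vertices m - hinges m. g S > 0) \<and> g w = -1 \<and>
    H w' + \<tau> w' v * (H v - H w') < (H v + H w) / 2 \<and>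
    (\<forall>u\<in>hinges m. \<forall>z\<in>Q_vertices m. f 1 z = 0 \<longrightarrow> f 2 z > 0 \<longrightarrow>
       \<bar>\<tau> u z * (H z - H u)\<bar> < \<epsilon>) \<and>
    (\<forall>u\<in>hinges m. \<forall>z\<in>Q_vertices m. \<forall>z'\<in>Q_vertices m.
       f 1 z > 0 \<longrightarrow> f 2 z = 0 \<longrightarrow> f 1 z' = 0 \<longrightarrow> f 2 z' > 0 \<longrightarrow>
       \<bar>\<tau> u z * (H z - H u)\<bar> < \<bar>\<tau> u z' * (H z' - H u)\<bar>)"
  proof (rule cut_parameters)
    show "finite (Q_vertices m)" "inj_on H (Q_vertices m)" "H v < H w" "\<epsilon> > 0" "w \<in> hinges m" "w' \<in> hinges m"
      by (fact finite_Q_vertices H_inj H_vw eps wW w'W)+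
    show "0 \<le> f 1 z \<and> 0 \<le> f 2 z \<and> 0 \<le> f 3 z \<and> 0 \<le> f (m + 5) z" if "z \<in> Q_vertices m" for z
      using f_nonneg[OF that] mem by blast
    show "hinges m = {z \<in> Q_vertices m. f 1 z = 0 \<and> f 2 z = 0} - {v}"
      using f_zero mem by (auto simp: hinges_def v_def)
    show "f 1 v = 0" "f 2 v = 0" "f 3 v = 0" "f (m + 5) v = 0" by (fact f_v)+
    show "f 3 w = 0" "f (m + 5) w > 0"
      using f_zero[of w 3] f_pos[of w "m + 5"] wW WQ mem by (auto simp: w_def)
    show "f 3 w' > 0" "f (m + 5) w' = 0"
      using f_pos[of w' 3] f_zero[of w' "m + 5"] w'W WQ mem by (auto simp: w'_def)
    show "f 3 z > 0" if "z \<in> hinges m" "z \<noteq> w" for z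
    proof -
      obtain j where j: "3 \<le> j" "z = hinge j" using \<open>z \<in> hinges m\<close> by (rule hingesE)
      then have "j \<noteq> 3" using that(2) w_def by auto
      then have "3 \<notin> z" using j by auto
      then show ?thesis using that WQ mem by (intro f_pos) auto
    qed
  qed
  then obtain al be la mu g \<tau> where
      g_all: "\<forall>S. g S = al * f 1 S + be * f 2 S - la * f 3 S - mu * f (m + 5) S + 1"
    and \<tau>_all: "\<forall>u z. \<tau> u z = - g u / (g z - g u)"
    and gW_all: "\<forall>S\<in>hinges m. g S < 0"
    and gK_all: "\<forall>S\<in>Q_vertices m - hinges m. g S > 0"
    and gw: "g w = -1"
    and first_low: "H w' + \<tau> w' v * (H v - H w') < (H v + H w) / 2"
    and near_all: "\<forall>u\<in>hinges m. \<forall>z\<in>Q_vertices m. f 1 z = 0 \<longrightarrow> f 2 z > 0 \<longrightarrow>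
       \<bar>\<tau> u z * (H z - H u)\<bar> < \<epsilon>"
    and nearer_all: "\<forall>u\<in>hinges m. \<forall>z\<in>Q_vertices m. \<forall>z'\<in>Q_vertices m.
       f 1 z > 0 \<longrightarrow> f 2 z = 0 \<longrightarrow> f 1 z' = 0 \<longrightarrow> f 2 z' > 0 \<longrightarrow>
       \<bar>\<tau> u z * (H z - H u)\<bar> < \<bar>\<tau> u z' * (H z' - H u)\<bar>"
    by (elim exE conjE) (rule that; assumption)
  note g_def = g_all[rule_format] and \<tau>_def = \<tau>_all[rule_format]
    and gW = gW_all[rule_format] and gK = gK_all[rule_format]
    and near = near_all[rule_format] and nearer = nearer_all[rule_format]

  define c where "c = al *\<^sub>R a 1 + be *\<^sub>R a 2 - la *\<^sub>R a 3 - mu *\<^sub>R a (m + 5)"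
  define e where "e = al * b 1 + be * b 2 - la * b 3 - mu * b (m + 5) - 1"
  have g_eq: "c \<bullet> X S - e = g S" for S
    by (simp add: c_def e_def g_def f_def inner_add_left inner_diff_left algebra_simps)
  have g_v: "g v = 1" unfolding g_def f_v by simp
  have label: "old.L x \<in> Q_vertices m \<and> X (old.L x) = x" if "x extreme_point_of old.P" for x
  proof -
    have "old.L x \<in> Q_vertices m" using bij that by (auto simp: bij_betw_def)
    moreover from this have "x = X (old.L x)"
      using X[of "old.L x"] by (intro old.tight_inj[OF that]) simp
    ultimately show ?thesis by simp
  qed
  have gen: "c \<bullet> x \<noteq> e" if "x extreme_point_of old.P" for x
    using label[OF that] g_eq[of "old.L x"] gW[of "old.L x"] gK[of "old.L x"] by fastforce

  \<comment> \<open>The new constraint is added under the fresh index 0; afterwards all indices are shifted up by one.\<close>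
  let ?a0 = "a(0 := c)" and ?b0 = "b(0 := e)" and ?I0 = "insert 0 {1..m + 5}"
  define a' where "a' i = ?a0 (i - 1)" for i
  define b' where "b' i = ?b0 (i - 1)" for i
  have comp: "a' \<circ> Suc = ?a0" "b' \<circ> Suc = ?b0" by (auto simp: a'_def b'_def)
  have img: "Suc ` ?I0 = {1..Suc m + 5}" by (auto simp: image_iff)
  have k: "0 \<notin> {1..m + 5}" by simp
  define P' where "P' = polyh {1..Suc m + 5} a' b'"
  define L' where "L' = tight {1..Suc m + 5} a' b'"
  have P': "P' = polyh ?I0 ?a0 ?b0"
    unfolding P'_def img[symmetric] polyh_reindex comp ..
  have L': "L' x = Suc ` tight ?I0 ?a0 ?b0 x" for x
    unfolding L'_def img[symmetric] tight_reindex comp ..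
  have sys': "simple_system {1..Suc m + 5} a' b'"
    unfolding img[symmetric]
    by (rule simple_system_reindex) (simp_all only: comp old.cut_simple[OF gen k] inj_Suc)
  interpret new: simple_system "{1..Suc m + 5}" a' b' by (rule sys')
  let ?E = "{x. x extreme_point_of P'}"

  have kept: "X S extreme_point_of P' \<and> L' (X S) = Suc ` S" if "S \<in> Q_vertices m - hinges m" for S
  proof -
    have "e < c \<bullet> X S" using gK[OF that] g_eq[of S] by simp
    then show ?thesis
      using X[of S] that old.cut_extreme_old[of "X S" e c, OF _ _ k]
      unfolding P' L' tight_insert[OF k] by simp
  qed
  have cut: "crossing c e (X S) (X T) extreme_point_of P' \<and>
      L' (crossing c e (X S) (X T)) = insert 1 (Suc ` (S \<inter> T)) \<and>
      crossing c e (X S) (X T) $ 4 = H S + \<tau> S T * (H T - H S)"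
    if S: "S \<in> hinges m" and T: "T \<in> Q_vertices m - hinges m" and card: "card (S \<inter> T) = 3" for S T
  proof -
    have lt: "c \<bullet> X S < e" "e < c \<bullet> X T" using gW[OF S] gK[OF T] g_eq[of S] g_eq[of T] by simp_all
    have XS: "X S extreme_point_of old.P" "old.L (X S) = S" using X[of S] S WQ by auto
    have XT: "X T extreme_point_of old.P" "old.L (X T) = T" using X[of T] T by auto
    have ext: "crossing c e (X S) (X T) extreme_point_of P'"
      unfolding P' by (rule old.cut_extreme_new[OF XS(1) lt(1) XT(1) lt(2) _ k])
        (simp only: XS(2) XT(2) card, simp)
    have "L' (crossing c e (X S) (X T)) = insert 1 (Suc ` (S \<inter> T))"
      using crossing_on[OF lt] old.tight_crossing(2)[OF old.in_P[OF XS(1)] lt(1) old.in_P[OF XT(1)] lt(2)]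
      unfolding L' tight_insert[OF k] XS(2) XT(2) by simp
    moreover have "(e - c \<bullet> X S) / (c \<bullet> X T - c \<bullet> X S) = \<tau> S T"
      using g_eq[of S] g_eq[of T] by (simp add: \<tau>_def algebra_simps)
    then have "crossing c e (X S) (X T) $ 4 = H S + \<tau> S T * (H T - H S)"
      by (simp add: crossing_def H_def)
    ultimately show ?thesis using ext by blast
  qed

  have inj': "inj_on L' ?E"
    unfolding L'_def P'_def by (rule inj_onI) (use new.tight_inj in auto)
  define X' where "X' = inv_into ?E L'"
  have X': "X' (L' x) = x" if "x extreme_point_of P'" for x
    unfolding X'_def using inj' that by (intro inv_into_f_f) auto
  define H' where "H' S = X' S $ 4" for S
  have H_kept: "Suc ` S \<in> L' ` ?E \<and> H' (Suc ` S) = H S" if "S \<in> Q_vertices m - hinges m" for S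
  proof -
    note * = kept[OF that]
    have "X' (Suc ` S) = X S" using * X'[of "X S"] by simp
    moreover have "Suc ` S \<in> L' ` ?E" using * by (intro image_eqI[of _ _ "X S"]) auto
    ultimately show ?thesis by (simp add: H'_def H_def)
  qed
  \<comment> \<open>Since the labels determine the vertices, the crossing of an edge is recovered from its label set.\<close>
  have H_cut: "insert 1 (Suc ` (S \<inter> T)) \<in> L' ` ?E \<and>
      H' (insert 1 (Suc ` (S \<inter> T))) = H S + \<tau> S T * (H T - H S)"
    if "S \<in> hinges m" "T \<in> Q_vertices m - hinges m" "card (S \<inter> T) = 3" for S T
  proof -
    let ?x = "crossing c e (X S) (X T)"
    note * = cut[OF that]
    have "X' (insert 1 (Suc ` (S \<inter> T))) = ?x" using * X'[of ?x] by simp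
    moreover have "insert 1 (Suc ` (S \<inter> T)) \<in> L' ` ?E" using * by (intro image_eqI[of _ _ ?x]) auto
    ultimately show ?thesis using * by (simp add: H'_def)
  qed
  have H_first: "{1, 2, 3, m + 6} \<in> L' ` ?E \<and> H' {1, 2, 3, m + 6} = H w' + \<tau> w' v * (H v - H w')"
  proof -
    have "w' \<inter> v = {1, 2, m + 5}" by (auto simp: w'_def v_def)
    then show ?thesis using H_cut[of w' v] w'W vQ vW by (simp add: eval_nat_numeral insert_commute)
  qed
  have H_second: "{1, 2, 3, 4} \<in> L' ` ?E \<and> H' {1, 2, 3, 4} = (H v + H w) / 2"
  proof -
    have "w \<inter> v = {1, 2, 3}" by (auto simp: w_def v_def)
    moreover have "\<tau> w v = 1 / 2" by (simp add: \<tau>_def gw g_v)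
    then have "H w + \<tau> w v * (H v - H w) = (H v + H w) / 2" by (simp add: field_simps)
    ultimately show ?thesis using H_cut[of w v] wW vQ vW by (simp add: eval_nat_numeral insert_commute)
  qed
  have H_split: "{1, 2, j + 1, j + 2} \<in> L' ` ?E \<and> {1, 3, j + 1, j + 2} \<in> L' ` ?E \<and>
      \<bar>H' {1, 2, j + 1, j + 2} - H (hinge j)\<bar> < \<epsilon> \<and>
      \<bar>H' {1, 3, j + 1, j + 2} - H (hinge j)\<bar> < \<bar>H' {1, 2, j + 1, j + 2} - H (hinge j)\<bar> \<and>
      (if even j then H' {1, 2, j + 1, j + 2} < H (hinge j) else H (hinge j) < H' {1, 2, j + 1, j + 2})"
    if j: "3 \<le> j" "j \<le> m + 4" for j
  proof -
    let ?S = "hinge j" and ?T2 = "{1, 3, max j 4, max j 4 + 1}"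
    have SW: "?S \<in> hinges m" using hinge_in_hinges[OF j] .
    note nbr = hinge_neighbours[OF j]
    obtain T3 where T3: "T3 \<in> Q_vertices m" "?S \<inter> T3 = {2, j, j + 1}" "1 \<notin> T3" using nbr(3) by blast
    have "2 \<notin> ?T2" by auto
    then have T2K: "?T2 \<in> Q_vertices m - hinges m" using nbr(1) by (auto simp: hinges_def)
    have T3K: "T3 \<in> Q_vertices m - hinges m" using T3 by (auto simp: hinges_def)
    have "2 \<in> T3" using T3(2) by blast
    have f2: "f 1 ?T2 = 0" "f 2 ?T2 > 0"
      using f_zero[OF nbr(1) mem(1)] f_pos[OF nbr(1) mem(2) \<open>2 \<notin> ?T2\<close>] by auto
    have f3: "f 1 T3 > 0" "f 2 T3 = 0"
      using f_pos[OF T3(1) mem(1) T3(3)] f_zero[OF T3(1) mem(2)] \<open>2 \<in> T3\<close> by auto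
    have c2: "card (?S \<inter> ?T2) = 3" and c3: "card (?S \<inter> T3) = 3"
      unfolding nbr(2) T3(2) using j by simp_all
    have "insert 1 (Suc ` (?S \<inter> ?T2)) = {1, 2, j + 1, j + 2}"
      unfolding nbr(2) by (simp add: eval_nat_numeral)
    then have h2: "{1, 2, j + 1, j + 2} \<in> L' ` ?E"
        "H' {1, 2, j + 1, j + 2} - H ?S = \<tau> ?S ?T2 * (H ?T2 - H ?S)"
      using H_cut[OF SW T2K c2] by simp_all
    have "insert 1 (Suc ` (?S \<inter> T3)) = {1, 3, j + 1, j + 2}"
      unfolding T3(2) by (simp add: eval_nat_numeral)
    then have h3: "{1, 3, j + 1, j + 2} \<in> L' ` ?E"
        "H' {1, 3, j + 1, j + 2} - H ?S = \<tau> ?S T3 * (H T3 - H ?S)"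
      using H_cut[OF SW T3K c3] by simp_all
    have t: "\<tau> ?S ?T2 > 0"
      unfolding \<tau>_def using gW[OF SW] gK[OF T2K] by (intro divide_pos_pos) linarith+
    have dir: "if even j then H ?T2 < H ?S else H ?S < H ?T2"
      using pi_path_hinge_order[OF path_lt j] .
    have "if even j then H' {1, 2, j + 1, j + 2} - H ?S < 0 else 0 < H' {1, 2, j + 1, j + 2} - H ?S"
      unfolding h2(2) using dir t by (simp add: mult_pos_neg split: if_splits)
    moreover have "\<bar>H' {1, 2, j + 1, j + 2} - H ?S\<bar> < \<epsilon>"
      unfolding h2(2) by (rule near[OF SW nbr(1) f2])
    moreover have "\<bar>H' {1, 3, j + 1, j + 2} - H ?S\<bar> < \<bar>H' {1, 2, j + 1, j + 2} - H ?S\<bar>"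
      unfolding h2(2) h3(2) by (rule nearer[OF SW T3(1) nbr(1) f3 f2])
    ultimately show ?thesis using h2(1) h3(1) by (auto split: if_splits)
  qed

  have bij': "bij_betw L' ?E (Q_vertices (Suc m))"
  proof -
    have "L' x \<in> Q_vertices (Suc m)" if x: "x \<in> ?E" for x
    proof -
      have x': "x extreme_point_of polyh ?I0 ?a0 ?b0" using x P' by simp
      from gen k x' show ?thesis
      proof (rule old.cut_extreme_cases)
        assume o: "x extreme_point_of old.P" "e < c \<bullet> x"
        let ?S = "old.L x"
        have S: "?S \<in> Q_vertices m" "X ?S = x" using label[OF o(1)] by auto
        then have "?S \<notin> hinges m" using gW[of ?S] g_eq[of ?S] o(2) by force
        then have "L' x = Suc ` ?S" "\<not> (1 \<in> ?S \<and> 2 \<in> ?S) \<or> ?S = {1, 2, 3, m + 5}"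
          using kept[of ?S] S by (auto simp: hinges_def)
        then show ?thesis using Suc_image_Q[OF S(1)] by simp
      next
        fix u z
        assume n: "u extreme_point_of old.P" "c \<bullet> u < e" "z extreme_point_of old.P" "e < c \<bullet> z"
          "card (old.L u \<inter> old.L z) = DIM(real ^ 4) - 1" "x = crossing c e u z"
        let ?S = "old.L u" and ?T = "old.L z"
        have S: "?S \<in> Q_vertices m" "X ?S = u" using label[OF n(1)] by auto
        have T: "?T \<in> Q_vertices m" "X ?T = z" using label[OF n(3)] by auto
        have SW: "?S \<in> hinges m" using gK[of ?S] g_eq[of ?S] S n(2) by force
        have TK: "?T \<notin> hinges m" using gW[of ?T] g_eq[of ?T] T n(4) by force
        have card: "card (?S \<inter> ?T) = 3" using n(5) by simp
        have "L' x = insert 1 (Suc ` (?S \<inter> ?T))"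
          using cut[of ?S ?T] SW TK T S card n(6) by simp
        then show ?thesis using cut_edge_label[OF SW T(1) TK card] by simp
      qed
    qed
    moreover have "S' \<in> L' ` ?E" if S': "S' \<in> Q_vertices (Suc m)" for S'
      using S'
    proof (cases rule: Q_Suc_cases)
      case (old S)
      then have "S \<in> Q_vertices m - hinges m" by (auto simp: hinges_def)
      then show ?thesis using H_kept old(3) by simp
    next
      case first
      then show ?thesis using H_first by simp
    next
      case second
      then show ?thesis using H_second by simp
    next
      case (a j)
      then show ?thesis using H_split[of j] by simp
    next
      case (b j)
      then show ?thesis using H_split[of j] by simp
    qed
    ultimately show ?thesis using inj' unfolding bij_betw_def by blast
  qed

  have sorted': "sorted_wrt (\<lambda>S T. H' S < H' T) (pi_path (Suc m))"
  proof -
    have U: "S \<in> Q_vertices m \<and> H v < H S \<and> H w \<le> H S" if "S \<in> set (even_stage m)" for S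
    proof -
      have "S \<in> Q_vertices m" using that by (simp flip: set_pi_path add: pi_path_def)
      moreover have "sorted_wrt (\<lambda>S T. H S < H T) (w # es)"
        using path_lt by (simp add: pi_path_def sorted_wrt_append es)
      then have "H w \<le> H S" using that by (auto simp: es)
      ultimately show ?thesis using v_even[OF that] by simp
    qed
    have split: "sorted_wrt (\<lambda>S T. H' S < H' T) (split_label S) \<and>
        (\<forall>T\<in>set (split_label S). \<bar>H' T - H S\<bar> < \<epsilon>)" if S: "S \<in> set (even_stage m)" for S
    proof (cases "S \<in> hinges m")
      case True
      then obtain j where j: "3 \<le> j" "j \<le> m + 4" "S = hinge j" by (rule hingesE)
      show ?thesis
        unfolding j(3) split_hinge[OF j(1)] using H_split[OF j(1,2)] by (auto split: if_splits)
    next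
      case False
      then have SK: "S \<in> Q_vertices m - hinges m" using U[OF S] by simp
      moreover have "S \<noteq> v" using U[OF S] by auto
      ultimately have "\<not> (1 \<in> S \<and> 2 \<in> S)" by (auto simp: hinges_def v_def)
      then have "split_label S = [Suc ` S]" by (simp only: split_label_def if_False)
      then show ?thesis using H_kept[OF SK] eps by simp
    qed
    have "sorted_wrt (\<lambda>S T. H S < H T) (even_stage m)"
      using path_lt by (simp add: pi_path_def sorted_wrt_append)
    then have "sorted_wrt (\<lambda>S T. H S + 2 * \<epsilon> \<le> H T) (even_stage m)"
      by (rule sorted_wrt_mono_rel[rotated]) (use U gap in auto)
    then have part3: "sorted_wrt (\<lambda>S T. H' S < H' T) (concat (map split_label (even_stage m)))"
      by (rule sorted_wrt_refine) (use split in blast)+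
    \<comment> \<open>The midpoint of \<open>v\<close> and \<open>w\<close> stays \<open>\<epsilon>\<close> below \<open>w\<close>, hence below all clusters.\<close>
    have second_low: "H' {1, 2, 3, 4} < H' T" if T: "T \<in> set (concat (map split_label (even_stage m)))" for T
    proof -
      obtain S where S: "S \<in> set (even_stage m)" "T \<in> set (split_label S)" using T by auto
      have "H v + 2 * \<epsilon> \<le> H w" using gap[OF vQ _ H_vw] wW WQ by blast
      moreover have "\<bar>H' T - H S\<bar> < \<epsilon>" using split S by blast
      moreover have "H w \<le> H S" using U[OF S(1)] by simp
      moreover have "H' {1, 2, 3, 4} = (H v + H w) / 2" using H_second by simp
      moreover have "x < t" if "p + 2 * \<epsilon> \<le> q" "\<bar>t - s\<bar> < \<epsilon>" "q \<le> s" "x = (p + q) / 2"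
        for p q s t x :: real
      proof -
        have "s - \<epsilon> < t" using that(2) by (simp add: abs_less_iff)
        moreover have "p \<le> q - 2 * \<epsilon>" using that(1) by simp
        ultimately show ?thesis using that(3,4) by (simp add: field_simps)
      qed
      ultimately show ?thesis by blast
    qed
    have first_second: "H v < H' {1, 2, 3, m + 6}" "H' {1, 2, 3, m + 6} < H' {1, 2, 3, 4}"
    proof -
      have "g w' < 0" using gW[OF w'W] .
      then have "\<tau> w' v < 1" unfolding \<tau>_def g_v by (subst pos_divide_less_eq) simp_all
      then have "0 < (1 - \<tau> w' v) * (H w' - H v)" using H_vw' by simp
      then show "H v < H' {1, 2, 3, m + 6}" using H_first by (simp add: algebra_simps)
      show "H' {1, 2, 3, m + 6} < H' {1, 2, 3, 4}" using H_first H_second first_low by simp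
    qed
    have H_odd: "H' (Suc ` S) = H S" if "S \<in> set (odd_stage (m + 5))" for S
      using H_kept odd_stage_not_hinge[OF that] by blast
    have odd_lt: "sorted_wrt (\<lambda>S T. H S < H T) (odd_stage (m + 5))"
      using path_lt by (simp add: pi_path_def sorted_wrt_append)
    have part1: "sorted_wrt (\<lambda>S T. H' S < H' T) (map ((`) Suc) (odd_stage (m + 5)))"
      unfolding sorted_wrt_map by (rule sorted_wrt_mono_rel[OF _ odd_lt]) (simp add: H_odd)
    have odd_low: "H' T \<le> H v" if T: "T \<in> set (map ((`) Suc) (odd_stage (m + 5)))" for T
    proof -
      obtain S where S: "S \<in> set (odd_stage (m + 5))" "T = Suc ` S" using T by auto
      moreover have "H S \<le> H v" using S(1) odd_lt by (auto simp: os sorted_wrt_append)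
      ultimately show ?thesis using H_odd by simp
    qed
    show ?thesis
      unfolding pi_path_Suc sorted_wrt_append
    proof (intro conjI ballI)
      fix S T assume S: "S \<in> set (map ((`) Suc) (odd_stage (m + 5)))"
        and T: "T \<in> set ([{1, 2, 3, m + 6}, {1, 2, 3, 4}] @ concat (map split_label (even_stage m)))"
      have "T \<in> set (concat (map split_label (even_stage m))) \<or> T = {1, 2, 3, m + 6} \<or> T = {1, 2, 3, 4}"
        using T unfolding set_append list.set by blast
      then have "H v < H' T"
        using first_second second_low[of T] by (elim disjE) (linarith | simp only:)+
      then show "H' S < H' T" using odd_low[OF S] by simp
    next
      fix S T assume S: "S \<in> set [{1, 2, 3, m + 6}, {1, 2, 3, 4}]"
        and T: "T \<in> set (concat (map split_label (even_stage m)))"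
      then show "H' S < H' T" using first_second(2) second_low[OF T] by auto
    qed (use part1 part3 first_second in simp_all)
  qed

  have "realization (Suc m) P' (facet_family (Suc m) a' b')"
    using realization_of_system[OF sys'] bij' unfolding P'_def L'_def by blast
  moreover have "pi_monotone (Suc m) P' (facet_family (Suc m) a' b')"
    unfolding P'_def
  proof (rule pi_monotone_of_system[OF sys'])
    show "bij_betw new.L {v. v extreme_point_of new.P} (Q_vertices (Suc m))"
      using bij' unfolding P'_def L'_def .
    show "X' S extreme_point_of new.P \<and> new.L (X' S) = S" if "S \<in> Q_vertices (Suc m)" for S
    proof -
      have "S \<in> L' ` ?E" using that bij' by (simp add: bij_betw_def)
      then obtain x where "x \<in> ?E" "S = L' x" by (rule imageE)
      then show ?thesis using X'[of x] unfolding P'_def L'_def by simp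
    qed
    show "sorted_wrt (\<lambda>S T. X' S $ 4 < X' T $ 4) (pi_path (Suc m))"
      using sorted' by (simp add: H'_def)
  qed
  moreover have "obtained_by_cut P P'"
  proof -
    have "c \<noteq> 0"
    proof
      assume "c = 0"
      then show False using g_eq[of v] g_eq[of w] g_v gw by simp
    qed
    moreover have "P' = P \<inter> {x. (- c) \<bullet> x \<le> - e}"
      unfolding P' P_eq polyh_insert[OF k] by auto
    ultimately show ?thesis unfolding obtained_by_cut_def by (intro exI[of _ "- c"] exI[of _ "- e"]) simp
  qed
  ultimately show ?thesis by blast
qed

section \<open>The simplex\<close>

text \<open>The facet normals of the simplex with vertices 0, (1,0,0,1), (0,1,0,2), (0,0,1,3)
  and (0,0,0,4), scaled to be integral. The heights 0, ..., 4 of the vertices are prescribed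
  first, and the facets are labeled so that the vertices in this order miss the labels 1, 4, 5,
  2, 3, which is the order of the path on the simplex.\<close>

definition base_normal :: "nat \<Rightarrow> real ^ 4" where
  "base_normal i =
     (if i = 4 then axis 1 4
      else if i = 5 then axis 2 4
      else if i = 2 then axis 3 4
      else if i = 3 then axis 4 1 - axis 1 1 - axis 2 2 - axis 3 3
      else - axis 4 1 - axis 1 3 - axis 2 2 - axis 3 1)"

definition base_offset :: "nat \<Rightarrow> real" where
  "base_offset i = (if i = 1 then - 4 else 0)"

lemma base_slack:
  "base_normal 1 \<bullet> x = - (3 * x $ 1 + 2 * x $ 2 + x $ 3 + x $ 4)"
  "base_normal 2 \<bullet> x = 4 * x $ 3"
  "base_normal 3 \<bullet> x = x $ 4 - x $ 1 - 2 * x $ 2 - 3 * x $ 3"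
  "base_normal 4 \<bullet> x = 4 * x $ 1"
  "base_normal 5 \<bullet> x = 4 * x $ 2"
  by (simp_all add: base_normal_def inner_diff_left inner_axis' )

text \<open>The index is the label that the vertex misses.\<close>

definition base_vertex :: "nat \<Rightarrow> real ^ 4" where
  "base_vertex k =
     (if k = 1 then 0
      else if k = 4 then axis 1 1 + axis 4 1
      else if k = 5 then axis 2 1 + axis 4 2
      else if k = 2 then axis 3 1 + axis 4 3
      else axis 4 4)"

lemma base_vertex_coords:
  "base_vertex 1 $ 1 = 0" "base_vertex 1 $ 2 = 0" "base_vertex 1 $ 3 = 0" "base_vertex 1 $ 4 = 0"
  "base_vertex 4 $ 1 = 1" "base_vertex 4 $ 2 = 0" "base_vertex 4 $ 3 = 0" "base_vertex 4 $ 4 = 1"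
  "base_vertex 5 $ 1 = 0" "base_vertex 5 $ 2 = 1" "base_vertex 5 $ 3 = 0" "base_vertex 5 $ 4 = 2"
  "base_vertex 2 $ 1 = 0" "base_vertex 2 $ 2 = 0" "base_vertex 2 $ 3 = 1" "base_vertex 2 $ 4 = 3"
  "base_vertex 3 $ 1 = 0" "base_vertex 3 $ 2 = 0" "base_vertex 3 $ 3 = 0" "base_vertex 3 $ 4 = 4"
  by (simp_all add: base_vertex_def axis_def)

lemma vec4_eq_iff: "(x :: real ^ 4) = y \<longleftrightarrow> x $ 1 = y $ 1 \<and> x $ 2 = y $ 2 \<and> x $ 3 = y $ 3 \<and> x $ 4 = y $ 4"
  by (simp add: vec_eq_iff forall_4)

lemma labels_5: "{1..0 + 5} = {1, 2, 3, 4, 5 :: nat}"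
  by auto

abbreviation base_simplex :: "(real ^ 4) set" where
  "base_simplex \<equiv> polyh {1..0 + 5} base_normal base_offset"

lemma base_simplex_iff: "x \<in> base_simplex \<longleftrightarrow> 3 * x $ 1 + 2 * x $ 2 + x $ 3 + x $ 4 \<le> 4 \<and> 0 \<le> x $ 3 \<and>
    x $ 1 + 2 * x $ 2 + 3 * x $ 3 \<le> x $ 4 \<and> 0 \<le> x $ 1 \<and> 0 \<le> x $ 2"
  unfolding polyh_def labels_5 by (auto simp: base_slack[unfolded One_nat_def] base_offset_def)

lemma base_tight_iff:
  "i \<in> tight {1..0 + 5} base_normal base_offset x \<longleftrightarrow>
     i = 1 \<and> 3 * x $ 1 + 2 * x $ 2 + x $ 3 + x $ 4 = 4 \<or> i = 2 \<and> x $ 3 = 0 \<or>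
     i = 3 \<and> x $ 4 = x $ 1 + 2 * x $ 2 + 3 * x $ 3 \<or> i = 4 \<and> x $ 1 = 0 \<or> i = 5 \<and> x $ 2 = 0"
  unfolding tight_def labels_5
  by (auto simp: base_slack[unfolded One_nat_def] base_offset_def)

lemma base_vertex_extreme:
  assumes k: "k \<in> {1, 2, 3, 4, 5}"
  shows "base_vertex k extreme_point_of base_simplex"
    and "tight {1..0 + 5} base_normal base_offset (base_vertex k) = {1, 2, 3, 4, 5} - {k}"
proof -
  show t: "tight {1..0 + 5} base_normal base_offset (base_vertex k) = {1, 2, 3, 4, 5} - {k}"
    using k unfolding set_eq_iff base_tight_iff
    by (elim insertE emptyE) (auto simp: base_vertex_coords base_vertex_coords[unfolded One_nat_def])
  have "base_vertex k \<in> base_simplex"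
    using k unfolding base_simplex_iff
    by (elim insertE emptyE) (auto simp: base_vertex_coords base_vertex_coords[unfolded One_nat_def])
  moreover have "pinned base_normal ({1, 2, 3, 4, 5} - {k})"
  proof -
    have "d = 0" if d: "\<And>i. i \<in> {1, 2, 3, 4, 5} - {k} \<Longrightarrow> base_normal i \<bullet> d = 0" for d
    proof -
      have "k \<noteq> 1 \<Longrightarrow> - (3 * d $ 1 + 2 * d $ 2 + d $ 3 + d $ 4) = 0" "k \<noteq> 2 \<Longrightarrow> 4 * d $ 3 = 0"
        "k \<noteq> 3 \<Longrightarrow> d $ 4 - d $ 1 - 2 * d $ 2 - 3 * d $ 3 = 0" "k \<noteq> 4 \<Longrightarrow> 4 * d $ 1 = 0"
        "k \<noteq> 5 \<Longrightarrow> 4 * d $ 2 = 0"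
        using d[of 1] d[of 2] d[of 3] d[of 4] d[of 5] unfolding base_slack by auto
      then show "d = 0" using k unfolding vec4_eq_iff by (elim insertE emptyE) auto
    qed
    then show ?thesis by (auto simp: pinned_def)
  qed
  ultimately show "base_vertex k extreme_point_of base_simplex"
    by (subst extreme_iff_pinned) (simp_all only: t finite_atLeastAtMost simp_thms)
qed

text \<open>At least four constraints are tight at a vertex, so at most one is not, and the four
  tight equations determine the point.\<close>

lemma base_extreme_is_vertex:
  assumes x: "x extreme_point_of base_simplex"
  shows "\<exists>k\<in>{1, 2, 3, 4, 5}. x = base_vertex k"
proof -
  let ?T = "tight {1..0 + 5} base_normal base_offset x"
  have mem: "x \<in> base_simplex" and pin: "pinned base_normal ?T"
    using x by (simp_all only: extreme_iff_pinned finite_atLeastAtMost)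
  have sub: "?T \<subseteq> {1, 2, 3, 4, 5}" unfolding subset_iff base_tight_iff by auto
  have "\<not> card ?T < 4"
  proof
    assume "card ?T < 4"
    then obtain d where "d \<noteq> 0" "\<forall>i\<in>?T. base_normal i \<bullet> d = 0"
      using common_kernel[of ?T base_normal] by (auto simp: tight_finite)
    then show False using pin pinnedD by blast
  qed
  moreover have "card ({1, 2, 3, 4, 5} - ?T) = 5 - card ?T"
    using card_Diff_subset[OF finite_subset[OF sub] sub] by simp
  ultimately have le: "card ({1, 2, 3, 4, 5} - ?T) \<le> Suc 0" by linarith
  have "finite ({1, 2, 3, 4, 5} - ?T)" by simp
  then have uniq: "\<forall>i\<in>{1, 2, 3, 4, 5} - ?T. \<forall>k\<in>{1, 2, 3, 4, 5} - ?T. i = k"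
    using le by (rule card_le_Suc0_iff_eq[THEN iffD1])
  have "\<not> (1 \<in> ?T \<and> 2 \<in> ?T \<and> 3 \<in> ?T \<and> 4 \<in> ?T \<and> 5 \<in> ?T)"
    unfolding base_tight_iff by auto
  then obtain k where k: "k \<in> {1, 2, 3, 4, 5}" "k \<notin> ?T" by blast
  have rest: "i \<in> ?T" if "i \<in> {1, 2, 3, 4, 5}" "i \<noteq> k" for i
    using uniq k that by blast
  have eqs: "k \<noteq> 1 \<Longrightarrow> 3 * x $ 1 + 2 * x $ 2 + x $ 3 + x $ 4 = 4" "k \<noteq> 2 \<Longrightarrow> x $ 3 = 0"
    "k \<noteq> 3 \<Longrightarrow> x $ 4 = x $ 1 + 2 * x $ 2 + 3 * x $ 3" "k \<noteq> 4 \<Longrightarrow> x $ 1 = 0" "k \<noteq> 5 \<Longrightarrow> x $ 2 = 0"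
    using rest[of 1] rest[of 2] rest[of 3] rest[of 4] rest[of 5] unfolding base_tight_iff by auto
  have "x = base_vertex k"
    using k(1) eqs unfolding vec4_eq_iff
    by (elim insertE emptyE) (auto simp: base_vertex_coords base_vertex_coords[unfolded One_nat_def])
  then show ?thesis using k(1) by blast
qed

lemma pi_path_0: "pi_path 0 = [{2, 3, 4, 5}, {1, 2, 3, 5}, {1, 2, 3, 4}, {1, 3, 4, 5}, {1, 2, 4, 5}]"
  by (simp add: pi_path_def odd_stage_def even_stage_block_def upt_rec) (simp add: numeral_eq_Suc)

lemma missing_labels:
  "{1, 2, 3, 4, 5} - {1} = {2, 3, 4, 5 :: nat}" "{1, 2, 3, 4, 5} - {2} = {1, 3, 4, 5 :: nat}"
  "{1, 2, 3, 4, 5} - {3} = {1, 2, 4, 5 :: nat}" "{1, 2, 3, 4, 5} - {4} = {1, 2, 3, 5 :: nat}"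
  "{1, 2, 3, 4, 5} - {5} = {1, 2, 3, 4 :: nat}"
  by auto

lemma Q_vertices_0: "Q_vertices 0 = (\<lambda>k. {1, 2, 3, 4, 5} - {k}) ` {1, 2, 3, 4, 5}"
proof -
  have "(\<lambda>k. {1, 2, 3, 4, 5} - {k}) ` {1, 2, 3, 4, 5 :: nat} = set (pi_path 0)"
    unfolding image_insert image_empty missing_labels pi_path_0 by (simp add: insert_commute)
  then show ?thesis by (simp only: set_pi_path)
qed

text \<open>The least missing label is the only one when exactly one of the five labels is
  missing.\<close>

definition base_point :: "nat set \<Rightarrow> real ^ 4" where
  "base_point S = base_vertex (if 1 \<notin> S then 1 else if 2 \<notin> S then 2 else if 3 \<notin> S then 3
     else if 4 \<notin> S then 4 else 5)"

lemma base_point_missing: "k \<in> {1, 2, 3, 4, 5} \<Longrightarrow> base_point ({1, 2, 3, 4, 5} - {k}) = base_vertex k"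
  unfolding base_point_def by auto

lemma base_system: "simple_system {1..0 + 5} base_normal base_offset"
proof
  have "base_simplex \<subseteq> cbox 0 (\<chi> i. 4)"
    unfolding subset_iff base_simplex_iff mem_box_cart forall_4 by auto
  then show "bounded base_simplex" using bounded_cbox bounded_subset by blast
  fix x assume "x extreme_point_of base_simplex"
  then obtain k where k: "k \<in> {1, 2, 3, 4, 5}" "x = base_vertex k"
    using base_extreme_is_vertex by blast
  show "card (tight {1..0 + 5} base_normal base_offset x) = DIM(real ^ 4)"
    unfolding k(2) base_vertex_extreme(2)[OF k(1)] using k(1) by auto
qed simp

lemma base_bij:
  "bij_betw (tight {1..0 + 5} base_normal base_offset) {v. v extreme_point_of base_simplex} (Q_vertices 0)"
proof -
  interpret simple_system "{1..0 + 5}" base_normal base_offset by (rule base_system)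
  have ext: "{v. v extreme_point_of base_simplex} = base_vertex ` {1, 2, 3, 4, 5}"
    using base_extreme_is_vertex base_vertex_extreme(1) by blast
  have "tight {1..0 + 5} base_normal base_offset ` base_vertex ` {1, 2, 3, 4, 5} =
      (\<lambda>k. {1, 2, 3, 4, 5} - {k}) ` {1, 2, 3, 4, 5}"
    unfolding image_image by (intro image_cong refl base_vertex_extreme(2))
  then show ?thesis
    unfolding bij_betw_def Q_vertices_0
    using tight_inj by (simp only: ext[symmetric]) (auto intro!: inj_onI)
qed

lemma base_case:
  "realization 0 base_simplex (facet_family 0 base_normal base_offset)"
  "pi_monotone 0 base_simplex (facet_family 0 base_normal base_offset)"
  "4 simplex base_simplex"
proof -
  show real: "realization 0 base_simplex (facet_family 0 base_normal base_offset)"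
    by (rule realization_of_system[OF base_system base_bij])
  show "pi_monotone 0 base_simplex (facet_family 0 base_normal base_offset)"
  proof (rule pi_monotone_of_system[OF base_system base_bij])
    show "base_point S extreme_point_of base_simplex \<and>
        tight {1..0 + 5} base_normal base_offset (base_point S) = S" if "S \<in> Q_vertices 0" for S
    proof -
      obtain k where k: "k \<in> {1, 2, 3, 4, 5}" "S = {1, 2, 3, 4, 5} - {k}"
        using \<open>S \<in> Q_vertices 0\<close> unfolding Q_vertices_0 by (rule imageE)
      show ?thesis
        unfolding k(2) base_point_missing[OF k(1)] using base_vertex_extreme[OF k(1)] by blast
    qed
    show "sorted_wrt (\<lambda>S T. base_point S $ 4 < base_point T $ 4) (pi_path 0)"
      unfolding pi_path_0 base_point_def
      by (simp add: base_vertex_coords base_vertex_coords[unfolded One_nat_def])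
  qed
  let ?E = "{v. v extreme_point_of base_simplex}"
  have hull: "base_simplex = convex hull ?E"
    using real polytope_imp_compact polytope_imp_convex
    by (intro Krein_Milman_Minkowski) (auto simp: realization_def)
  have "card ?E = card (Q_vertices 0)" using base_bij by (rule bij_betw_same_card)
  also have "\<dots> = 5"
  proof -
    have "inj_on (\<lambda>k. A - {k}) A" for A :: "nat set"
      by (auto simp: inj_on_def)
    note * = card_image[OF this]
    show ?thesis unfolding Q_vertices_0 * by simp
  qed
  finally have card: "card ?E = 5" .
  have "aff_dim ?E = 4"
    using real hull unfolding realization_def by (metis aff_dim_convex_hull)
  then have "\<not> affine_dependent ?E"
    unfolding affine_independent_iff_card using card by (auto intro: card_ge_0_finite)
  then show "4 simplex base_simplex"
    unfolding simplex_def using card hull by (intro exI[of _ ?E]) simp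
qed

section \<open>The family\<close>

theorem theorem2p5:
  shows "(\<exists>(Q :: nat \<Rightarrow> (real ^ 4) set) (F :: nat \<Rightarrow> nat \<Rightarrow> (real ^ 4) set).
            4 simplex Q 0 \<and>
            (\<forall>m. realization m (Q m) (F m) \<and> pi_monotone m (Q m) (F m)) \<and>
            (\<forall>m. obtained_by_cut (Q m) (Q (Suc m)))) \<and>
         (\<forall>m (P :: (real ^ 4) set) (F :: nat \<Rightarrow> (real ^ 4) set).
            realization m P F \<and> pi_monotone m P F \<longrightarrow>
            (\<exists>P' F'. obtained_by_cut P P' \<and>
                     realization (Suc m) P' F' \<and> pi_monotone (Suc m) P' F'))"
proof (intro conjI allI impI)
  let ?inv = "\<lambda>m (P, F). realization m P F \<and> pi_monotone m P F \<and> (m = 0 \<longrightarrow> 4 simplex P)"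
  have "\<exists>s. \<forall>m. ?inv m (s m) \<and> obtained_by_cut (fst (s m)) (fst (s (Suc m)))"
  proof (rule dependent_nat_choice)
    show "\<exists>s. ?inv 0 s" using base_case by blast
    show "\<exists>s'. ?inv (Suc m) s' \<and> obtained_by_cut (fst s) (fst s')" if "?inv m s" for s m
      using that inductive_step[of m "fst s" "snd s"] by (auto simp: case_prod_beta)
  qed
  then obtain s where s: "\<forall>m. ?inv m (s m) \<and> obtained_by_cut (fst (s m)) (fst (s (Suc m)))" ..
  show "\<exists>(Q :: nat \<Rightarrow> (real ^ 4) set) (F :: nat \<Rightarrow> nat \<Rightarrow> (real ^ 4) set).
      4 simplex Q 0 \<and>
      (\<forall>m. realization m (Q m) (F m) \<and> pi_monotone m (Q m) (F m)) \<and>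
      (\<forall>m. obtained_by_cut (Q m) (Q (Suc m)))"
    using s by (intro exI[of _ "\<lambda>m. fst (s m)"] exI[of _ "\<lambda>m. snd (s m)"]) (simp add: case_prod_beta)
qed (elim conjE, rule inductive_step)

end
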